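(* Let $n \geq 2$ be an integer, let $\alpha \in (0,n)$ and let $\delta \in (0,1)$. There exist a metric space $(X,d)$ of finite Hausdorff $n$-measure and a quasisymmetric homeomorphism $f\colon [0,1]^n \rightarrow X$ (with $[0,1]^n$ carrying the Euclidean metric) with the property that $f$ maps some Borel set $E \subset [0,1]^n$ of Lebesgue measure $|E| \geq \delta$ onto a subset $f(E)$ of $X$ with Hausdorff dimension at most $\alpha$.
   Context: A homeomorphism $f\colon (X,d_X) \rightarrow (Y,d_Y)$ between metric spaces is quasisymmetric if there exists a homeomorphism $\eta\colon [0, \infty) \rightarrow [0, \infty)$ such that $$\frac{d_Y(f(x),f(y))}{d_Y(f(x),f(z))} \leq \eta\left( \frac{d_X(x,y)}{d_X(x,z)} \right)$$ for all triples of distinct points $x,y,z \in X$. $|E|$ denotes the Lebesgue $n$-measure of $E$. Hausdorff measure and Hausdorff dimension in $X$ are taken with respect to the metric $d$. *)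

theory Defs
  imports "HOL-Analysis.Analysis"
begin

text \<open>
  Metric spaces are given by a carrier \<open>X\<close> and a distance \<open>d\<close> satisfying the locale predicate
  \<^const>\<open>Metric_space\<close>, since the theorem asserts the existence of a metric.
\<close>

definition quasisymmetric_homeomorphism ::
    "'a set \<Rightarrow> ('a \<Rightarrow> 'a \<Rightarrow> real) \<Rightarrow> 'b set \<Rightarrow> ('b \<Rightarrow> 'b \<Rightarrow> real) \<Rightarrow> ('a \<Rightarrow> 'b) \<Rightarrow> bool" where
  "quasisymmetric_homeomorphism X dX Y dY f \<longleftrightarrow>
     homeomorphic_map (Metric_space.mtopology X dX) (Metric_space.mtopology Y dY) f \<and>
     (\<exists>(\<eta> :: real \<Rightarrow> real) \<eta>'. homeomorphism {0..} {0..} \<eta> \<eta>' \<and>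
        (\<forall>x\<in>X. \<forall>y\<in>X. \<forall>z\<in>X. x \<noteq> y \<and> y \<noteq> z \<and> x \<noteq> z \<longrightarrow>
           dY (f x) (f y) / dY (f x) (f z) \<le> \<eta> (dX x y / dX x z)))"

definition mdiameter :: "('a \<Rightarrow> 'a \<Rightarrow> real) \<Rightarrow> 'a set \<Rightarrow> ennreal" where
  "mdiameter d U = (SUP x\<in>U. SUP y\<in>U. ennreal (d x y))"

text \<open>
  The summand \<open>(diam U)\<^sup>s\<close>, with the usual conventions that the empty set contributes \<open>0\<close> and that
  \<open>(diam U)\<^sup>0 = 1\<close> for nonempty \<open>U\<close> (whereas \<^term>\<open>0 powr 0 = (0::real)\<close>). It is only applied to sets of
  finite diameter, so \<^const>\<open>enn2real\<close> loses nothing.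
\<close>

definition diameter_power :: "('a \<Rightarrow> 'a \<Rightarrow> real) \<Rightarrow> real \<Rightarrow> 'a set \<Rightarrow> ennreal" where
  "diameter_power d s U =
     (if U = {} then 0 else if s = 0 then 1 else ennreal (enn2real (mdiameter d U) powr s))"

definition hausdorff_content ::
    "'a set \<Rightarrow> ('a \<Rightarrow> 'a \<Rightarrow> real) \<Rightarrow> real \<Rightarrow> real \<Rightarrow> 'a set \<Rightarrow> ennreal" where
  "hausdorff_content X d s \<epsilon> A =
     (INF U \<in> {U :: nat \<Rightarrow> 'a set. (\<forall>i. U i \<subseteq> X \<and> mdiameter d (U i) \<le> ennreal \<epsilon>) \<and> A \<subseteq> (\<Union>i. U i)}.
        \<Sum>i. diameter_power d s (U i))"

text \<open>
  The \<open>s\<close>-dimensional Hausdorff (outer) measure, without the normalising constant depending only on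
  \<open>s\<close>; the constant affects neither finiteness nor vanishing of the measure.
\<close>

definition hausdorff_measure ::
    "'a set \<Rightarrow> ('a \<Rightarrow> 'a \<Rightarrow> real) \<Rightarrow> real \<Rightarrow> 'a set \<Rightarrow> ennreal" where
  "hausdorff_measure X d s A = (SUP \<epsilon>\<in>{0<..}. hausdorff_content X d s \<epsilon> A)"

definition hausdorff_dimension :: "'a set \<Rightarrow> ('a \<Rightarrow> 'a \<Rightarrow> real) \<Rightarrow> 'a set \<Rightarrow> ennreal" where
  "hausdorff_dimension X d A = (INF s \<in> {s. 0 \<le> s \<and> hausdorff_measure X d s A = 0}. ennreal s)"

end

theory Submission
  imports Defs
begin

text \<open>
  We take \<open>X = [0,1]\<^sup>n\<close> and \<open>f = id\<close>, and change only the metric. Every \<open>N\<close>-adic cube \<open>Q\<close> of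
  generation \<open>m\<close> receives a weight \<open>w(Q)\<close>, and the new metric satisfies \<open>d(x,y) \<approx> N\<^sup>-\<^sup>m w(Q)\<close> when
  \<open>x \<in> Q\<close> and \<open>|x - y| \<approx> N\<^sup>-\<^sup>m\<close>. A child of \<open>Q\<close> inherits \<open>w(Q)\<close> times \<open>1\<close> in the outermost layer of
  children, times \<open>K \<approx> N/2\<close> in the second layer, and times a tiny \<open>q\<close> elsewhere, unless \<open>Q\<close> is frozen,
  in which case the weight no longer changes. A cube is frozen as soon as \<open>w(Q) > B \<lambda>\<^sup>m\<close>. Hence all
  weights are bounded, the identity is Lipschitz, and the Hausdorff \<open>n\<close>-measure is finite; on the set
  of points that are never frozen the weights decay like \<open>\<lambda>\<^sup>m\<close>, which makes its dimension at most
  \<open>\<alpha>\<close>; and Markov's inequality for a small moment of \<open>w\<close> shows that this set is large.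

  Because the outer layer has factor \<open>1\<close>, neighbouring cubes always have comparable weights, which
  gives quasisymmetry. The heavy second layer ensures that distances do not collapse: there
  is a radial self-map of \<open>Q\<close> which fixes the outer layer and whose Lipschitz constant on each child
  is at most the factor of that child. Composing a bump function around \<open>Q\<close> with these maps for all
  finer cubes produces a function that still separates \<open>Q\<close> from the cubes not touching it, and
  whose oscillation on each finer cube is controlled by the weight of that cube. The metric \<open>d\<close> is the
  supremum of the pseudometrics defined by these functions.
\<close>

section \<open>Auxiliary facts on the sup-norm, uniformly equivalent metrics, finite covers and
  integer boxes\<close>

lemma infnorm_le_iff_cart:
  fixes x :: "real ^ 'n"
  shows "infnorm x \<le> D \<longleftrightarrow> (\<forall>i. \<bar>x $ i\<bar> \<le> D)"
proof
  assume "infnorm x \<le> D"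
  then show "\<forall>i. \<bar>x $ i\<bar> \<le> D"
    using component_le_infnorm_cart[of x] order_trans by blast
next
  assume "\<forall>i. \<bar>x $ i\<bar> \<le> D"
  then show "infnorm x \<le> D"
    by (auto simp: infnorm_Max Basis_vec_def inner_axis)
qed

lemma infnorm_ge_cart:
  fixes x :: "real ^ 'n"
  shows "\<bar>x $ i\<bar> \<le> infnorm x"
  using component_le_infnorm_cart by blast

lemma div_mult_frame:
  fixes k :: int
  assumes "0 < N"
  shows "int N * (k div int N) \<le> k" "k + 1 \<le> int N * (k div int N) + int N"
proof -
  have "k = int N * (k div int N) + k mod int N" by simp
  moreover have "0 \<le> k mod int N" "k mod int N < int N" using assms by auto
  ultimately show "int N * (k div int N) \<le> k" "k + 1 \<le> int N * (k div int N) + int N" by linarith+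
qed

lemma mtopology_cong_uniform:
  assumes "Metric_space X d1" "Metric_space X d2"
    and 12: "\<And>e. 0 < e \<Longrightarrow> \<exists>r>0. \<forall>x\<in>X. \<forall>y\<in>X. d1 x y < r \<longrightarrow> d2 x y < e"
    and 21: "\<And>e. 0 < e \<Longrightarrow> \<exists>r>0. \<forall>x\<in>X. \<forall>y\<in>X. d2 x y < r \<longrightarrow> d1 x y < e"
  shows "Metric_space.mtopology X d1 = Metric_space.mtopology X d2"
proof -
  have *: "openin (Metric_space.mtopology X b) U"
    if a: "Metric_space X a" and b: "Metric_space X b" and U: "openin (Metric_space.mtopology X a) U"
      and ab: "\<And>e. 0 < e \<Longrightarrow> \<exists>r>0. \<forall>x\<in>X. \<forall>y\<in>X. b x y < r \<longrightarrow> a x y < e"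
    for a b U
    unfolding Metric_space.openin_mtopology[OF b]
  proof (intro conjI allI impI)
    show UX: "U \<subseteq> X" using U by (simp add: Metric_space.openin_mtopology[OF a])
    fix x assume x: "x \<in> U"
    then obtain e where e: "e > 0" "Metric_space.mball X a x e \<subseteq> U"
      using U by (auto simp: Metric_space.openin_mtopology[OF a])
    obtain r where "r > 0" "\<forall>x\<in>X. \<forall>y\<in>X. b x y < r \<longrightarrow> a x y < e" using ab[OF e(1)] by blast
    then have "Metric_space.mball X b x r \<subseteq> Metric_space.mball X a x e"
      by (auto simp: Metric_space.in_mball[OF a] Metric_space.in_mball[OF b])
    then show "\<exists>r>0. Metric_space.mball X b x r \<subseteq> U" using e \<open>r > 0\<close> by blast
  qed
  show ?thesis
    unfolding topology_eq using *[of d1 d2] *[of d2 d1] assms by blast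
qed

text \<open>The least \<open>l\<close> satisfying the first inequality satisfies the second, which
  is the failure of the first at \<open>l - 1\<close>, or \<open>t \<le> 1\<close> when
  \<open>l = 0\<close>. With \<open>b = N\<close> this finds the generation that matches a given
  separation.\<close>

lemma power_level_exists:
  fixes t b :: real
  assumes "1 < b" "0 < t" "t \<le> 1"
  obtains l where "1 / b ^ Suc l < t" "t \<le> 1 / b ^ l"
proof -
  define P where "P l \<longleftrightarrow> 1 / b ^ Suc l < t" for l
  obtain m where "(1 / b) ^ m < t" using real_arch_pow_inv[of t "1 / b"] assms by auto
  moreover have "(1 / b) ^ Suc m \<le> (1 / b) ^ m" using assms by (intro power_decreasing) auto
  ultimately have "P m" unfolding P_def by (simp add: power_one_over)
  define l where "l = (LEAST l. P l)"
  have 1: "P l" unfolding l_def by (rule LeastI[of P, OF \<open>P m\<close>])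
  have "t \<le> 1 / b ^ l"
  proof (cases l)
    case 0 then show ?thesis using assms by simp
  next
    case (Suc l')
    then have "\<not> P l'" unfolding l_def by (metis lessI not_less_Least)
    then show ?thesis using Suc by (simp add: P_def)
  qed
  then show thesis using that 1 by (simp add: P_def)
qed

text \<open>Supplies the control function \<open>\<eta>\<close>; one exponent will serve small
  ratios of distances, the other large ones.\<close>

lemma sum_powr_homeomorphism:
  fixes a b A :: real
  assumes "0 < a" "0 < b" "0 < A"
  shows "\<exists>\<eta>'. homeomorphism {0..} {0..} (\<lambda>t. A * (t powr a + t powr b)) \<eta>'"
proof (rule homeomorphism_into_1d)
  let ?f = "\<lambda>t. A * (t powr a + t powr b)"
  show "path_connected {0::real..}" by (intro convex_imp_path_connected) auto
  show cont: "continuous_on {0..} ?f"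
    using assms by (intro continuous_intros continuous_on_powr') auto
  have mono: "?f s < ?f t" if "0 \<le> s" "s < t" for s t
    using that assms by (intro mult_strict_left_mono add_strict_mono powr_less_mono2) auto
  show "inj_on ?f {0..}"
    by (rule inj_onI) (metis mono atLeast_iff less_irrefl linorder_neqE_linordered_idom)
  show "?f ` {0..} = {0..}"
  proof (intro equalityI subsetI)
    fix y :: real assume "y \<in> {0..}"
    then have y: "0 \<le> y" by simp
    \<comment> \<open>\<open>T\<close> solves \<open>A * T powr a = y\<close>, so
      \<open>?f T\<close> is at least \<open>y\<close> and the intermediate value theorem applies on
      the interval from \<open>0\<close> to \<open>T\<close>.\<close>
    define T where "T = (y / A) powr (1 / a)"
    have "T powr a = y / A" using assms y by (simp add: T_def powr_powr)
    then have "y \<le> ?f T" using assms by (simp add: distrib_left)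
    moreover have "?f 0 \<le> y" using y by simp
    moreover have "0 \<le> T" by (simp add: T_def)
    ultimately obtain x where "0 \<le> x" "?f x = y"
      using IVT'[of ?f 0 y T] continuous_on_subset[OF cont] by auto
    then show "y \<in> ?f ` {0..}" by force
  qed (use assms in auto)
qed

text \<open>A finite cover is padded to a sequence with empty sets, which contribute
  \<open>0\<close>. Both Hausdorff estimates below rest on this bound.\<close>

lemma hausdorff_content_le_finite:
  assumes "finite I" and s: "0 < s" and r: "0 \<le> r" "r \<le> \<epsilon>"
    and VX: "\<And>i. i \<in> I \<Longrightarrow> V i \<subseteq> X"
    and diam: "\<And>i x y. i \<in> I \<Longrightarrow> x \<in> V i \<Longrightarrow> y \<in> V i \<Longrightarrow> d x y \<le> r"
    and cover: "A \<subseteq> (\<Union>i\<in>I. V i)"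
  shows "hausdorff_content X d s \<epsilon> A \<le> ennreal (real (card I) * r powr s)"
proof -
  obtain h where h: "bij_betw h {0..<card I} I" using ex_bij_betw_nat_finite[OF assms(1)] by blast
  then have hI: "h n \<in> I" if "n < card I" for n using that by (auto simp: bij_betw_def)
  define U where "U n = (if n < card I then V (h n) else {})" for n
  have md: "mdiameter d (U n) \<le> ennreal r" for n
    unfolding mdiameter_def U_def using diam[OF hI] by (auto intro!: SUP_least ennreal_leI)
  have dp: "diameter_power d s (U n) \<le> ennreal (r powr s)" for n
  proof -
    have "enn2real (mdiameter d (U n)) \<le> r" using md[of n] r by (intro enn2real_leI) auto
    then show ?thesis using s by (auto simp: diameter_power_def intro!: ennreal_leI powr_mono2)
  qed
  have "A \<subseteq> (\<Union>n. U n)"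
  proof
    fix x assume "x \<in> A"
    then obtain i where "i \<in> I" "x \<in> V i" using cover by blast
    moreover from this obtain n where "n < card I" "h n = i" using h by (force simp: bij_betw_def)
    ultimately show "x \<in> (\<Union>n. U n)" by (auto simp: U_def)
  qed
  moreover have "U n \<subseteq> X" for n using VX[OF hI] by (auto simp: U_def)
  moreover have "mdiameter d (U n) \<le> ennreal \<epsilon>" for n
    using md[of n] ennreal_leI[OF r(2)] order_trans by blast
  ultimately have "hausdorff_content X d s \<epsilon> A \<le> (\<Sum>n. diameter_power d s (U n))"
    unfolding hausdorff_content_def by (intro INF_lower) auto
  also have "\<dots> = (\<Sum>n<card I. diameter_power d s (U n))"
    by (rule suminf_finite) (auto simp: U_def diameter_power_def)
  also have "\<dots> \<le> (\<Sum>n<card I. ennreal (r powr s))" by (intro sum_mono dp)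
  also have "\<dots> = ennreal (real (card I) * r powr s)"
    by (simp add: ennreal_mult ennreal_of_nat_eq_real_of_nat)
  finally show ?thesis .
qed

definition index_box :: "nat \<Rightarrow> ('n :: finite \<Rightarrow> int) set" where
  "index_box r = {k. \<forall>i. 0 \<le> k i \<and> k i < int r}"

lemma index_box_PiE: "index_box r = PiE UNIV (\<lambda>_. {0..<int r})"
  by (auto simp: index_box_def PiE_def Pi_def)

lemma finite_index_box [simp]: "finite (index_box r)"
  unfolding index_box_PiE by (intro finite_PiE) auto

lemma card_index_box: "card (index_box r :: ('n :: finite \<Rightarrow> int) set) = r ^ CARD('n)"
  unfolding index_box_PiE by (subst card_PiE) auto

section \<open>Weights on nested cubes\<close>

locale weight_cascade =
  fixes N :: nat and q lam B :: real
  assumes N8: "8 \<le> N" and q: "0 < q" "q \<le> 1" and lam: "0 < lam" "lam \<le> 1" and B: "1 \<le> B"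
begin

text \<open>This will be the Lipschitz constant of the radial map: \<open>1\<close> because
  \<open>g \<le> 1\<close>, plus the slope \<open>N\<close> of \<open>g\<close> times the scaled
  half-width \<open>1/2\<close> of a cube.\<close>

definition K :: real where "K = 1 + real N / 2"

definition par :: "('n \<Rightarrow> int) \<Rightarrow> 'n \<Rightarrow> int" where
  "par k = (\<lambda>i. k i div int N)"

definition digit :: "('n \<Rightarrow> int) \<Rightarrow> 'n \<Rightarrow> int" where
  "digit k = (\<lambda>i. k i mod int N)"

text \<open>Since \<open>q\<close> will be tiny, a path can enter the light inner part of a cube only through the layer of
  factor \<open>K\<close>, at a cost comparable to the size of the whole cube.\<close>
definition fac :: "('n \<Rightarrow> int) \<Rightarrow> real" where
  "fac d = (if \<exists>i. d i = 0 \<or> d i = int N - 1 then 1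
            else if \<exists>i. d i = 1 \<or> d i = int N - 2 then K else q)"

text \<open>Indices range over all integer vectors, so the cascade fills the whole space and
  comparisons between neighbours never meet a boundary. The freezing test is written out because
  \<open>active\<close> is itself defined from \<open>wt\<close>.\<close>

primrec wt :: "nat \<Rightarrow> ('n \<Rightarrow> int) \<Rightarrow> real" where
  "wt 0 k = 1"
| "wt (Suc m) k =
     wt m (par k) * (if wt m (par k) \<le> B * lam ^ m then fac (digit k) else 1)"

definition active :: "nat \<Rightarrow> ('n \<Rightarrow> int) \<Rightarrow> bool" where
  "active m k \<longleftrightarrow> wt m k \<le> B * lam ^ m"

lemma wt_Suc: "wt (Suc m) k = wt m (par k) * (if active m (par k) then fac (digit k) else 1)"
  by (simp add: active_def)

text \<open>The intended diameter of the cube in the new metric, up to a constant factor.\<close>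

definition sz :: "nat \<Rightarrow> ('n \<Rightarrow> int) \<Rightarrow> real" where
  "sz m k = wt m k / real N ^ m"

text \<open>The cubes are closed, whereas \<open>idx m x\<close> selects the half-open cube containing \<open>x\<close>.\<close>
definition cube :: "nat \<Rightarrow> ('n \<Rightarrow> int) \<Rightarrow> (real ^ 'n) set" where
  "cube m k = {x. \<forall>i. of_int (k i) \<le> real N ^ m * x $ i \<and> real N ^ m * x $ i \<le> of_int (k i) + 1}"

definition idx :: "nat \<Rightarrow> real ^ 'n \<Rightarrow> 'n \<Rightarrow> int" where
  "idx m x = (\<lambda>i. \<lfloor>real N ^ m * x $ i\<rfloor>)"

definition adj :: "('n \<Rightarrow> int) \<Rightarrow> ('n \<Rightarrow> int) \<Rightarrow> bool" where
  "adj k l \<longleftrightarrow> (\<forall>i. \<bar>k i - l i\<bar> \<le> 1)"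

definition center :: "nat \<Rightarrow> ('n \<Rightarrow> int) \<Rightarrow> real ^ 'n" where
  "center m k = (\<chi> i. (of_int (k i) + 1/2) / real N ^ m)"

text \<open>The profile in terms of the scaled sup-norm radius: \<open>1\<close> in the outer layer
  of width \<open>1 / N\<close>, \<open>q\<close> from depth \<open>2 / N\<close> inwards, and a
  transition of slope at most \<open>N\<close> in between.\<close>

definition g :: "real \<Rightarrow> real" where
  "g r = max q (min 1 (2 - real N * (1/2 - r)))"

definition radial :: "nat \<Rightarrow> ('n \<Rightarrow> int) \<Rightarrow> real ^ 'n \<Rightarrow> real ^ 'n" where
  "radial m k x = center m k + g (real N ^ m * infnorm (x - center m k)) *\<^sub>R (x - center m k)"

definition G :: "nat \<Rightarrow> real ^ 'n \<Rightarrow> real ^ 'n" where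
  "G m x = (if active m (idx m x) then radial m (idx m x) x else x)"

lemma Npos: "0 < real N" "0 < N" "1 < real N" "0 < int N" using N8 by auto
lemma NNpos [simp]: "0 < real N ^ m" using Npos by simp

lemma K_bounds: "1 \<le> K" "K < real N" "0 < K" using N8 by (auto simp: K_def)

lemma fac_bounds: "q \<le> fac d" "fac d \<le> K" "0 < fac d"
  using q K_bounds by (auto simp: fac_def)

lemma wt_pos: "0 < wt m k"
  by (induction m arbitrary: k) (auto simp: wt_Suc fac_bounds simp del: wt.simps(2))

lemma wt_step: "q * wt m (par k) \<le> wt (Suc m) k" "wt (Suc m) k \<le> K * wt m (par k)"
  using wt_pos[of m "par k"] fac_bounds[of "digit k"] q K_bounds
  by (auto simp: wt_Suc mult.commute simp del: wt.simps(2))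

lemma wt_ge: "q ^ m \<le> wt m k"
proof (induction m arbitrary: k)
  case (Suc m)
  have "q ^ Suc m \<le> q * wt m (par k)" using Suc q by simp
  then show ?case using wt_step(1) order_trans by blast
qed simp

text \<open>A weight changes only below an active parent, whose weight is at most \<open>B\<close>,
  and then by a factor of at most \<open>K\<close>.\<close>

lemma wt_le: "wt m k \<le> B * K"
proof (induction m arbitrary: k)
  case 0
  have "1 * 1 \<le> B * K" by (rule mult_mono) (use B K_bounds in auto)
  then show ?case by simp
next
  case (Suc m)
  show ?case
  proof (cases "active m (par k)")
    case True
    have "lam ^ m \<le> 1" using lam by (simp add: power_le_one)
    then have "B * lam ^ m \<le> B * 1" by (rule mult_left_mono) (use B in auto)
    then have "wt m (par k) \<le> B" using True by (simp add: active_def)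
    then have "wt m (par k) * K \<le> B * K" by (rule mult_right_mono) (use K_bounds in auto)
    then show ?thesis using wt_step(2)[of m k] by (simp add: mult.commute del: wt.simps(2))
  next
    case False
    then show ?thesis using Suc by (simp add: wt_Suc del: wt.simps(2))
  qed
qed

text \<open>Below a frozen cube the weight stays constant while the threshold does not increase, so
  freezing is permanent.\<close>

lemma active_par: assumes "active (Suc m) k" shows "active m (par k)"
proof (rule ccontr)
  assume n: "\<not> active m (par k)"
  then have "wt (Suc m) k = wt m (par k)" by (simp add: wt_Suc del: wt.simps(2))
  moreover have "B * lam ^ Suc m \<le> B * lam ^ m"
    using lam B by (intro mult_left_mono) (auto simp: mult_left_le_one_le)
  ultimately show False using assms n by (simp add: active_def del: wt.simps(2))
qed

lemma sz_pos: "0 < sz m k" unfolding sz_def by (intro divide_pos_pos wt_pos NNpos)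

lemma sz_step: "q / N * sz m (par k) \<le> sz (Suc m) k" "sz (Suc m) k \<le> K / N * sz m (par k)"
  using wt_step[of m k] Npos by (simp_all add: sz_def field_simps del: wt.simps(2))

lemma adj_sym: "adj k l \<Longrightarrow> adj l k" by (simp add: adj_def abs_minus_commute)

text \<open>A difference of quotients enters \<open>a - b\<close> multiplied by \<open>N\<close>.
  The remainders can compensate it only if it is at most \<open>1\<close> in absolute value, and if
  it is nonzero both remainders must be extreme.\<close>

lemma adj_par_aux:
  fixes a b :: int
  assumes "\<bar>a - b\<bar> \<le> 1"
  shows "\<bar>a div int N - b div int N\<bar> \<le> 1"
    "a div int N \<noteq> b div int N \<Longrightarrow>
       (a mod int N = 0 \<or> a mod int N = int N - 1) \<and> (b mod int N = 0 \<or> b mod int N = int N - 1)"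
proof -
  define n where "n = int N"
  have n: "n \<ge> 8" using N8 by (simp add: n_def)
  have *: "a = n * (a div n) + a mod n" "b = n * (b div n) + b mod n" by auto
  have m: "0 \<le> a mod n" "a mod n < n" "0 \<le> b mod n" "b mod n < n" using n by auto
  have eq: "a - b = n * (a div n - b div n) + (a mod n - b mod n)"
    unfolding right_diff_distrib using * by linarith
  have "\<bar>a div n - b div n\<bar> \<le> 1"
  proof (rule ccontr)
    assume "\<not> ?thesis"
    then consider "a div n - b div n \<ge> 2" | "a div n - b div n \<le> -2" by linarith
    then show False
    proof cases
      case 1
      then have "n * (a div n - b div n) \<ge> n * 2" using n by (intro mult_left_mono) auto
      then show False using eq m assms n by linarith
    next
      case 2
      then have "n * (a div n - b div n) \<le> n * (-2)" using n by (intro mult_left_mono) auto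
      then show False using eq m assms n by linarith
    qed
  qed
  then show "\<bar>a div int N - b div int N\<bar> \<le> 1" by (simp add: n_def)
  assume "a div int N \<noteq> b div int N"
  then have "a div n - b div n = 1 \<or> a div n - b div n = -1"
    using \<open>\<bar>a div n - b div n\<bar> \<le> 1\<close> by (auto simp: n_def)
  then have "a - b = n + (a mod n - b mod n) \<or> a - b = -n + (a mod n - b mod n)"
    using eq by auto
  then have "(a mod n = 0 \<or> a mod n = n - 1) \<and> (b mod n = 0 \<or> b mod n = n - 1)"
    using m assms by linarith
  then show "(a mod int N = 0 \<or> a mod int N = int N - 1) \<and> (b mod int N = 0 \<or> b mod int N = int N - 1)"
    by (simp add: n_def)
qed

lemma adj_par: "adj k l \<Longrightarrow> adj (par k) (par l)"
  using adj_par_aux(1) by (simp add: adj_def par_def)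

text \<open>Once two adjacent cubes have different parents, both lie in the outer layer of their parent,
  so the ratio of their weights is inherited unchanged.\<close>
lemma adj_wt: "adj k l \<Longrightarrow> wt m k \<le> K / q * wt m l"
proof (induction m arbitrary: k l)
  case 0
  then show ?case using q K_bounds by (simp add: field_simps)
next
  case (Suc m)
  show ?case
  proof (cases "par k = par l")
    case True
    have "wt (Suc m) k \<le> K * wt m (par l)" using wt_step(2)[of m k] True by simp
    also have "\<dots> = K / q * (q * wt m (par l))" using q by simp
    also have "\<dots> \<le> K / q * wt (Suc m) l"
      by (rule mult_left_mono[OF wt_step(1)]) (use q K_bounds in auto)
    finally show ?thesis .
  next
    case False
    then obtain i where "k i div int N \<noteq> l i div int N" by (auto simp: par_def)
    moreover have "\<bar>k i - l i\<bar> \<le> 1" using Suc.prems by (simp add: adj_def)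
    ultimately have "digit k i = 0 \<or> digit k i = int N - 1" "digit l i = 0 \<or> digit l i = int N - 1"
      using adj_par_aux(2)[of "k i" "l i"] by (auto simp: digit_def)
    then have "fac (digit k) = 1" "fac (digit l) = 1"
      unfolding fac_def by (simp_all only: if_P exI)
    then show ?thesis using Suc.IH[OF adj_par[OF Suc.prems]]
      by (simp add: wt_Suc del: wt.simps(2))
  qed
qed

lemma adj_sz: assumes "adj k l" shows "sz m k \<le> K / q * sz m l"
  using divide_right_mono[OF adj_wt[OF assms, of m], of "real N ^ m"] by (simp add: sz_def)

lemma cube_idx: "x \<in> cube m (idx m x)"
  by (simp add: cube_def idx_def)

lemma par_idx: "par (idx (Suc m) x) = idx m x"
proof
  fix i
  have "\<lfloor>(real N ^ Suc m * x $ i) / real_of_int (int N)\<rfloor> = \<lfloor>real N ^ Suc m * x $ i\<rfloor> div int N"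
    by (rule floor_divide_real_eq_div) simp
  moreover have "(real N ^ Suc m * x $ i) / real_of_int (int N) = real N ^ m * x $ i"
    using Npos by simp
  ultimately show "par (idx (Suc m) x) i = idx m x i" by (simp add: par_def idx_def)
qed

lemma cube_par: assumes "x \<in> cube (Suc m) k" shows "x \<in> cube m (par k)"
  unfolding cube_def
proof (intro CollectI allI)
  fix i
  have 1: "of_int (k i) \<le> real N * (real N ^ m * x $ i)" "real N * (real N ^ m * x $ i) \<le> of_int (k i) + 1"
    using assms by (auto simp: cube_def algebra_simps)
  have "real_of_int (int N * (k i div int N)) \<le> of_int (k i)"
    "real_of_int (k i + 1) \<le> of_int (int N * (k i div int N) + int N)"
    using div_mult_frame[OF Npos(2)] of_int_le_iff by blast+
  then have "real N * of_int (par k i) \<le> of_int (k i)"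
    "of_int (k i) + 1 \<le> real N * (of_int (par k i) + 1)"
    by (simp_all add: par_def distrib_left)
  then have "real N * of_int (par k i) \<le> real N * (real N ^ m * x $ i)"
    "real N * (real N ^ m * x $ i) \<le> real N * (of_int (par k i) + 1)"
    using 1 by linarith+
  then show "of_int (par k i) \<le> real N ^ m * x $ i \<and> real N ^ m * x $ i \<le> of_int (par k i) + 1"
    using Npos by (simp add: mult_le_cancel_left_pos)
qed

lemma cube_child: assumes "x \<in> cube m k" shows "\<exists>l. par l = k \<and> x \<in> cube (Suc m) l"
proof -
  \<comment> \<open>On an upper face of the closed cube the floor index may point to a child of the
    next cube; the \<open>min\<close> then selects the last child of \<open>k\<close>
    instead.\<close>
  define l where "l = (\<lambda>i. min (idx (Suc m) x i) (int N * k i + (int N - 1)))"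
  have "par l i = k i \<and> of_int (l i) \<le> real N ^ Suc m * x $ i \<and> real N ^ Suc m * x $ i \<le> of_int (l i) + 1" for i
  proof -
    define y where "y = real N ^ m * x $ i"
    have y: "of_int (k i) \<le> y" "y \<le> of_int (k i) + 1" using assms by (auto simp: cube_def y_def)
    have e: "real N ^ Suc m * x $ i = real N * y" by (simp add: y_def)
    have b: "real N * of_int (k i) \<le> real N * y" "real N * y \<le> real N * of_int (k i) + real N"
      using y Npos mult_left_mono[OF y(2), of "real N"] by (auto simp: algebra_simps)
    have ix: "idx (Suc m) x i = \<lfloor>real N * y\<rfloor>" by (simp add: idx_def y_def mult.assoc)
    have "int N * k i \<le> \<lfloor>real N * y\<rfloor>" using b by (simp add: le_floor_iff)
    then have l: "int N * k i \<le> l i" "l i < int N * (k i + 1)" 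
      using Npos by (auto simp: l_def ix algebra_simps min_less_iff_disj)
    have "l i div int N = k i"
      using l Npos by (intro int_div_pos_eq[where r = "l i - int N * k i"]) (auto simp: algebra_simps)
    moreover have "of_int (l i) \<le> real N * y"
    proof -
      have "l i \<le> \<lfloor>real N * y\<rfloor>" by (simp add: l_def ix)
      then show ?thesis by (simp add: le_floor_iff)
    qed
    moreover have "real N * y \<le> of_int (l i) + 1"
    proof (cases "l i = \<lfloor>real N * y\<rfloor>")
      case True then show ?thesis by linarith
    next
      case False
      then have "l i = int N * k i + (int N - 1)" by (auto simp: l_def ix min_def)
      then show ?thesis using b by simp
    qed
    ultimately show ?thesis unfolding e par_def by blast
  qed
  then show ?thesis by (intro exI[of _ l]) (auto simp: cube_def)
qed

section \<open>Test functions\<close>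

lemma scaled_dist_center:
  "real N ^ m * \<bar>(x - center m k) $ i\<bar> = \<bar>real N ^ m * x $ i - (of_int (k i) + 1/2)\<bar>"
proof -
  have "real N ^ m * \<bar>(x - center m k) $ i\<bar> = \<bar>real N ^ m * (x - center m k) $ i\<bar>"
    by (simp add: abs_mult)
  also have "real N ^ m * (x - center m k) $ i = real N ^ m * x $ i - (of_int (k i) + 1/2)"
    using NNpos[of m] by (simp add: center_def right_diff_distrib del: NNpos)
  finally show ?thesis .
qed

lemma scaled_le_iff:
  "real N ^ m * infnorm (x - center m k) \<le> D \<longleftrightarrow>
     (\<forall>i. \<bar>real N ^ m * x $ i - (of_int (k i) + 1/2)\<bar> \<le> D)"
proof -
  have "real N ^ m * infnorm (x - center m k) \<le> D \<longleftrightarrow> infnorm (x - center m k) \<le> D / real N ^ m"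
    using NNpos[of m] by (simp add: pos_le_divide_eq mult.commute del: NNpos)
  also have "\<dots> \<longleftrightarrow> (\<forall>i. \<bar>(x - center m k) $ i\<bar> \<le> D / real N ^ m)"
    by (rule infnorm_le_iff_cart)
  also have "\<dots> \<longleftrightarrow> (\<forall>i. real N ^ m * \<bar>(x - center m k) $ i\<bar> \<le> D)"
    using NNpos[of m] by (simp add: pos_le_divide_eq mult.commute del: NNpos)
  finally show ?thesis by (simp only: scaled_dist_center)
qed

lemma scaled_ge: "\<bar>real N ^ m * x $ i - (of_int (k i) + 1/2)\<bar> \<le> real N ^ m * infnorm (x - center m k)"
  using scaled_le_iff[of m x k "real N ^ m * infnorm (x - center m k)"] by blast

lemma cube_iff: "x \<in> cube m k \<longleftrightarrow> real N ^ m * infnorm (x - center m k) \<le> 1/2"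
proof -
  have "\<bar>y - (a + 1/2)\<bar> \<le> 1/2 \<longleftrightarrow> a \<le> y \<and> y \<le> a + 1" for y a :: real
    unfolding abs_le_iff by auto
  then show ?thesis unfolding scaled_le_iff by (simp add: cube_def)
qed

lemma cube_diam: assumes "u \<in> cube m k" "v \<in> cube m k" shows "infnorm (u - v) \<le> 1 / real N ^ m"
  unfolding infnorm_le_iff_cart
proof
  fix i
  have "real N ^ m * \<bar>(u - v) $ i\<bar> = \<bar>real N ^ m * u $ i - real N ^ m * v $ i\<bar>"
    by (simp add: abs_mult flip: right_diff_distrib)
  also have "\<dots> \<le> 1" using assms by (force simp: cube_def abs_le_iff dest: spec[of _ i])
  finally show "\<bar>(u - v) $ i\<bar> \<le> 1 / real N ^ m"
    using NNpos[of m] by (simp add: pos_le_divide_eq mult.commute del: NNpos)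
qed

section \<open>Radial maps and their Lipschitz constants on children\<close>

lemma g_bounds: "0 < g r" "g r \<le> 1" using q by (auto simp: g_def)

lemma g_collar: assumes "1/2 - 1/N \<le> r" shows "g r = 1"
proof -
  have "real N * (1/2 - r) \<le> real N * (1/N)" using assms by (intro mult_left_mono) auto
  then show ?thesis using q Npos by (auto simp: g_def)
qed

lemma g_interior: assumes "r \<le> 1/2 - 2/N" shows "g r = q"
proof -
  have "real N * (2/N) \<le> real N * (1/2 - r)" using assms by (intro mult_left_mono) auto
  then show ?thesis using q Npos by (auto simp: g_def)
qed

lemma g_lipschitz: "\<bar>g r - g t\<bar> \<le> real N * \<bar>r - t\<bar>"
proof -
  have "\<bar>g r - g t\<bar> \<le> \<bar>(2 - real N * (1/2 - r)) - (2 - real N * (1/2 - t))\<bar>"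
    unfolding g_def by linarith
  also have "(2 - real N * (1/2 - r)) - (2 - real N * (1/2 - t)) = real N * (r - t)"
    by (simp add: algebra_simps)
  finally show ?thesis by (simp add: abs_mult)
qed

lemma radial_collar:
  assumes "1/2 - 1/N \<le> real N ^ m * infnorm (x - center m k)"
  shows "radial m k x = x"
  using g_collar[OF assms] by (simp add: radial_def)

text \<open>A point shared by two distinct closed cubes has a coordinate on a face, so its scaled
  radius is at least \<open>1/2\<close> and it lies in the layer fixed by
  \<open>radial\<close>.\<close>

lemma radial_boundary:
  assumes "x \<in> cube m k" "x \<in> cube m l" "k \<noteq> l"
  shows "radial m k x = x"
proof -
  obtain i where i: "k i \<noteq> l i" using assms(3) by auto
  have 1: "of_int (k i) \<le> real N ^ m * x $ i" "real N ^ m * x $ i \<le> of_int (k i) + 1"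
    "of_int (l i) \<le> real N ^ m * x $ i" "real N ^ m * x $ i \<le> of_int (l i) + 1"
    using assms by (auto simp: cube_def)
  then have "real N ^ m * x $ i = of_int (k i) \<or> real N ^ m * x $ i = of_int (k i) + 1"
    using i by linarith
  then have "\<bar>real N ^ m * x $ i - (of_int (k i) + 1/2)\<bar> = 1/2" by auto
  moreover have "0 < 1 / real N" using Npos by simp
  ultimately show ?thesis using scaled_ge[of m x i k] by (intro radial_collar) linarith
qed

text \<open>Since the radial maps fix the faces, the formula does not depend on which of several
  closed cubes containing \<open>x\<close> is chosen by \<open>idx\<close>.\<close>

lemma G_cube:
  assumes "x \<in> cube m k"
  shows "G m x = (if active m k then radial m k x else x)"
  using radial_boundary[OF assms cube_idx[of x m]] radial_boundary[OF cube_idx[of x m] assms]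
  by (cases "k = idx m x") (auto simp: G_def)

lemma G_in_cube: assumes "x \<in> cube m k" shows "G m x \<in> cube m k"
proof (cases "active m k")
  case True
  have "infnorm (radial m k x - center m k) \<le> infnorm (x - center m k)"
    using g_bounds by (simp add: radial_def infnorm_mul infnorm_pos_le mult_left_le_one_le less_imp_le)
  then have "real N ^ m * infnorm (radial m k x - center m k) \<le> real N ^ m * infnorm (x - center m k)"
    by (intro mult_left_mono) auto
  then show ?thesis using assms True by (simp add: G_cube cube_iff)
qed (use assms in \<open>simp add: G_cube\<close>)

lemma radial_lipschitz:
  assumes "u \<in> cube m k" "v \<in> cube m k"
  shows "infnorm (radial m k u - radial m k v) \<le> K * infnorm (u - v)"
proof -
  define a b where ab: "a = u - center m k" "b = v - center m k"
  define r t where rt: "r = real N ^ m * infnorm a" "t = real N ^ m * infnorm b"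
  have t: "0 \<le> t" "t \<le> 1/2" using assms by (auto simp: rt ab cube_iff infnorm_pos_le)
  \<comment> \<open>The first summand is a contracted copy of \<open>a - b\<close>; the second
    measures the change of the scaling factor and is controlled by the slope of \<open>g\<close> and
    by \<open>t \<le> 1/2\<close>.\<close>
  have "radial m k u - radial m k v = g r *\<^sub>R (a - b) + (g r - g t) *\<^sub>R b"
    by (simp add: radial_def ab rt algebra_simps)
  then have "infnorm (radial m k u - radial m k v) \<le> g r * infnorm (a - b) + \<bar>g r - g t\<bar> * infnorm b"
    using infnorm_triangle[of "g r *\<^sub>R (a - b)" "(g r - g t) *\<^sub>R b"] g_bounds[of r]
    by (simp add: infnorm_mul)
  also have "\<dots> \<le> 1 * infnorm (a - b) + (real N * \<bar>r - t\<bar>) * infnorm b"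
    using g_bounds[of r] g_lipschitz
    by (intro add_mono mult_right_mono infnorm_pos_le) auto
  also have "\<bar>r - t\<bar> = real N ^ m * \<bar>infnorm a - infnorm b\<bar>"
    unfolding rt by (simp add: abs_mult flip: right_diff_distrib)
  also have "real N * (real N ^ m * \<bar>infnorm a - infnorm b\<bar>) * infnorm b
     = real N * \<bar>infnorm a - infnorm b\<bar> * t" by (simp add: rt)
  also have "\<dots> \<le> real N * infnorm (a - b) * (1/2)"
    using t absdiff_infnorm[of a b] by (intro mult_mono) (auto simp: infnorm_pos_le)
  finally have "infnorm (radial m k u - radial m k v) \<le> 1 * infnorm (a - b) + real N * infnorm (a - b) * (1/2)"
    by simp
  then show ?thesis by (simp add: ab K_def algebra_simps)
qed

text \<open>This explains the values of \<open>fac\<close>: in an active parent the radial map is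
  the identity on the outer layer of children, has its global constant \<open>K\<close> on the
  second layer, and is a homothety of ratio \<open>q\<close> on all other children.\<close>

lemma G_lipschitz:
  assumes u: "u \<in> cube (Suc m) k" and v: "v \<in> cube (Suc m) k"
  shows "infnorm (G m u - G m v) \<le> (if active m (par k) then fac (digit k) else 1) * infnorm (u - v)"
proof (cases "active m (par k)")
  case False
  then show ?thesis using u v by (simp add: G_cube[OF cube_par])
next
  case True
  note Gr = G_cube[OF cube_par[OF u]] G_cube[OF cube_par[OF v]]
  have frame: "of_int (par k i) + of_int (digit k i) / N \<le> real N ^ m * w $ i"
    "real N ^ m * w $ i \<le> of_int (par k i) + (of_int (digit k i) + 1) / N"
    if "w \<in> cube (Suc m) k" for w i
  proof -
    have "k i = int N * par k i + digit k i" by (simp add: par_def digit_def)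
    then have "real_of_int (k i) = real N * of_int (par k i) + of_int (digit k i)" by simp
    moreover have "of_int (k i) \<le> real N * (real N ^ m * w $ i)"
      "real N * (real N ^ m * w $ i) \<le> of_int (k i) + 1"
      using that by (simp_all add: cube_def mult.assoc)
    ultimately have "real N * of_int (par k i) + of_int (digit k i) \<le> real N * (real N ^ m * w $ i)"
       "real N * (real N ^ m * w $ i) \<le> real N * of_int (par k i) + of_int (digit k i) + 1"
      by linarith+
    then show "of_int (par k i) + of_int (digit k i) / N \<le> real N ^ m * w $ i"
    "real N ^ m * w $ i \<le> of_int (par k i) + (of_int (digit k i) + 1) / N"
      using Npos by (simp_all add: field_simps)
  qed
  consider (collar) "\<exists>i. digit k i = 0 \<or> digit k i = int N - 1"
    | (shell) "fac (digit k) = K"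
    | (inner) "\<forall>i. digit k i \<notin> {0, 1, int N - 2, int N - 1}" "fac (digit k) = q"
  proof (cases "\<exists>i. digit k i = 0 \<or> digit k i = int N - 1")
    case c: False
    show thesis
    proof (cases "\<exists>i. digit k i = 1 \<or> digit k i = int N - 2")
      case True
      then have "fac (digit k) = K" unfolding fac_def if_not_P[OF c] by (rule if_P)
      then show thesis by (rule that(2))
    next
      case False
      then have "fac (digit k) = q" unfolding fac_def if_not_P[OF c] by (rule if_not_P)
      then show thesis using c False by (intro that(3)) auto
    qed
  qed (rule that(1))
  then show ?thesis
  proof cases
    case collar
    then obtain i where i: "digit k i = 0 \<or> digit k i = int N - 1" by blast
    have "radial m (par k) w = w" if "w \<in> cube (Suc m) k" for w
    proof (rule radial_collar)
      have "1/2 - 1/N \<le> \<bar>real N ^ m * w $ i - (of_int (par k i) + 1/2)\<bar>"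
        using i
      proof
        assume "digit k i = 0"
        then show ?thesis using frame[OF that, of i] by simp
      next
        assume "digit k i = int N - 1"
        then have "of_int (digit k i) / N = 1 - 1 / real N" using Npos by (simp add: field_simps)
        then show ?thesis using frame(1)[OF that, of i] by simp
      qed
      then show "1/2 - 1/N \<le> real N ^ m * infnorm (w - center m (par k))"
        using scaled_ge order_trans by blast
    qed
    moreover have "fac (digit k) = 1" using collar unfolding fac_def by (rule if_P)
    ultimately show ?thesis using True u v by (simp add: Gr)
  next
    case shell
    then show ?thesis using True radial_lipschitz[OF cube_par[OF u] cube_par[OF v]] by (simp add: Gr)
  next
    case inner
    have "radial m (par k) w = center m (par k) + q *\<^sub>R (w - center m (par k))"
      if "w \<in> cube (Suc m) k" for w
    proof -
      have "real N ^ m * infnorm (w - center m (par k)) \<le> 1/2 - 2/N"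
        unfolding scaled_le_iff
      proof
        fix i
        have "0 \<le> digit k i" "digit k i < int N" using Npos by (auto simp: digit_def)
        then have "2 \<le> digit k i" "digit k i \<le> int N - 3"
          using inner(1)[rule_format, of i] by auto
        then have "2 \<le> real_of_int (digit k i)" "real_of_int (digit k i) + 1 \<le> real N - 2" by linarith+
        then have "2 / real N \<le> of_int (digit k i) / N"
          "(of_int (digit k i) + 1) / N \<le> (real N - 2) / N"
          using Npos by (auto intro: divide_right_mono)
        moreover have "(real N - 2) / N = 1 - 2 / real N" using Npos by (simp add: diff_divide_distrib)
        ultimately have "2 / real N \<le> of_int (digit k i) / N" "(of_int (digit k i) + 1) / N \<le> 1 - 2 / real N"
          by simp_all
        then show "\<bar>real N ^ m * w $ i - (of_int (par k i) + 1/2)\<bar> \<le> 1/2 - 2/N"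
          using frame[OF that, of i] unfolding abs_le_iff by linarith
      qed
      then show ?thesis by (simp add: radial_def g_interior)
    qed
    from this[OF u] this[OF v]
    have "radial m (par k) u - radial m (par k) v = q *\<^sub>R (u - v)"
      by (simp add: scaleR_diff_right)
    then show ?thesis using True q inner by (simp add: Gr infnorm_mul)
  qed
qed

section \<open>Compositions of the radial maps over successive generations, and their limit\<close>

lemma cube_anc: "x \<in> cube (l + n) k \<Longrightarrow> x \<in> cube l ((par ^^ n) k)"
proof (induction n arbitrary: k)
  case (Suc n)
  then have "x \<in> cube (l + n) (par k)" using cube_par by simp
  then show ?case using Suc.IH by (simp add: funpow_swap1)
qed simp

lemma cube_desc: "x \<in> cube l k \<Longrightarrow> \<exists>k'. (par ^^ n) k' = k \<and> x \<in> cube (l + n) k'"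
proof (induction n)
  case (Suc n)
  then obtain k' where k': "(par ^^ n) k' = k" "x \<in> cube (l + n) k'" by blast
  obtain k'' where "par k'' = k'" "x \<in> cube (Suc (l + n)) k''" using cube_child[OF k'(2)] by blast
  then show ?case using k' by (intro exI[of _ k'']) (auto simp: funpow_swap1)
qed simp

lemma idx_anc: "(par ^^ n) (idx (l + n) x) = idx l x"
  by (induction n) (auto simp: funpow_swap1 par_idx)

lemma G_in_coarse_cube: assumes "x \<in> cube l k" "l \<le> m" shows "G m x \<in> cube l k"
proof -
  obtain k' where "(par ^^ (m - l)) k' = k" "x \<in> cube m k'"
    using cube_desc[OF assms(1), of "m - l"] assms(2) by auto
  then show ?thesis using cube_anc[of _ l "m - l"] G_in_cube assms(2) by fastforce
qed

text \<open>\<open>C j m\<close> is the composition \<open>G j \<circ> G (j + 1) \<circ> \<dots> \<circ> G (m - 1)\<close>.\<close>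
primrec C :: "nat \<Rightarrow> nat \<Rightarrow> real ^ 'n \<Rightarrow> real ^ 'n" where
  "C j 0 x = x"
| "C j (Suc m) x = (if j \<le> m then C j m (G m x) else x)"

lemma C_trivial: "m \<le> j \<Longrightarrow> C j m x = x"
  by (cases m) auto

lemma C_split: "j \<le> l \<Longrightarrow> l \<le> m \<Longrightarrow> C j m x = C j l (C l m x)"
proof (induction m arbitrary: x)
  case (Suc m)
  then show ?case by (cases "l = Suc m") (auto simp: C_trivial)
qed simp

lemma C_in_cube: "x \<in> cube l k \<Longrightarrow> C l m x \<in> cube l k"
  by (induction m arbitrary: x) (auto simp: G_in_coarse_cube)

text \<open>The finest map contributes the factor of cube \<open>k\<close> and keeps both points in
  its parent, where the induction hypothesis applies. The factors telescope to a quotient of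
  weights.\<close>

lemma C_lipschitz:
  "u \<in> cube (j + n) k \<Longrightarrow> v \<in> cube (j + n) k \<Longrightarrow>
     infnorm (C j (j + n) u - C j (j + n) v) \<le> wt (j + n) k / wt j ((par ^^ n) k) * infnorm (u - v)"
proof (induction n arbitrary: k u v)
  case 0
  then show ?case using wt_pos[of j k] by (simp add: C_trivial)
next
  case (Suc n)
  let ?f = "if active (j + n) (par k) then fac (digit k) else 1"
  let ?r = "wt (j + n) (par k) / wt j ((par ^^ n) (par k))"
  have uv: "u \<in> cube (Suc (j + n)) k" "v \<in> cube (Suc (j + n)) k" using Suc.prems by auto
  have "infnorm (C j (j + n) (G (j + n) u) - C j (j + n) (G (j + n) v))
     \<le> ?r * infnorm (G (j + n) u - G (j + n) v)"
    by (intro Suc.IH G_in_cube cube_par uv)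
  also have "\<dots> \<le> ?r * (?f * infnorm (u - v))"
    by (intro mult_left_mono G_lipschitz uv) (simp add: wt_pos less_imp_le)
  also have "\<dots> = wt (Suc (j + n)) k / wt j ((par ^^ Suc n) k) * infnorm (u - v)"
    by (simp add: wt_Suc funpow_swap1 del: wt.simps(2))
  finally show ?case by simp
qed

definition Phi :: "nat \<Rightarrow> real ^ 'n \<Rightarrow> real ^ 'n" where
  "Phi j x = lim (\<lambda>m. C j m x)"

text \<open>For \<open>j \<le> m\<close>, \<open>C j (Suc m) x\<close> is \<open>C j m\<close>
  evaluated at \<open>G m x\<close>, which shares a generation-\<open>m\<close> cube with
  \<open>x\<close>. The Lipschitz constant there is at most \<open>B * K / q ^ j\<close> uniformly
  in \<open>m\<close>, so the increments decay geometrically.\<close>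

lemma C_step: "infnorm (C j (Suc m) x - C j m x) \<le> B * K / q ^ j * (1 / real N) ^ m"
proof (cases "j \<le> m")
  case False
  then show ?thesis using B K_bounds q by (simp add: C_trivial infnorm_0)
next
  case True
  then obtain n where m: "m = j + n" using le_Suc_ex by blast
  have x: "x \<in> cube (j + n) (idx (j + n) x)" "G (j + n) x \<in> cube (j + n) (idx (j + n) x)"
    by (simp_all add: cube_idx G_in_cube)
  have "infnorm (C j (Suc m) x - C j m x)
     \<le> wt (j + n) (idx (j + n) x) / wt j ((par ^^ n) (idx (j + n) x)) * infnorm (G (j + n) x - x)"
    using C_lipschitz[OF x(2,1)] by (simp add: m)
  also have "\<dots> \<le> (B * K / q ^ j) * (1 / real N ^ m)"
    using cube_diam[OF x(2,1)] q B K_bounds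
    by (intro mult_mono frac_le wt_le wt_ge) (auto simp: m wt_pos infnorm_pos_le less_imp_le)
  finally show ?thesis by (simp add: power_one_over)
qed

lemma C_tendsto:
  fixes x :: "real ^ 'n"
  shows "(\<lambda>m. C j m x) \<longlonglongrightarrow> Phi j x"
proof -
  have "summable (\<lambda>m. C j (Suc m) x - C j m x)"
  proof (rule summable_comparison_test')
    show "summable (\<lambda>m. sqrt (real DIM(real^'n)) * (B * K / q ^ j) * (1 / real N) ^ m)"
      using Npos by (intro summable_mult summable_geometric) auto
    fix m
    have "norm (C j (Suc m) x - C j m x) \<le> sqrt (real DIM(real^'n)) * infnorm (C j (Suc m) x - C j m x)"
      by (rule norm_le_infnorm)
    also have "\<dots> \<le> sqrt (real DIM(real^'n)) * (B * K / q ^ j * (1 / real N) ^ m)"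
      by (intro mult_left_mono C_step) auto
    finally show "norm (C j (Suc m) x - C j m x) \<le> sqrt (real DIM(real^'n)) * (B * K / q ^ j) * (1 / real N) ^ m"
      by (simp add: mult.assoc)
  qed
  then have "convergent (\<lambda>n. C j 0 x + (\<Sum>m<n. C j (Suc m) x - C j m x))"
    by (intro convergent_add convergent_const) (simp add: summable_iff_convergent)
  then have "convergent (\<lambda>m. C j m x)"
    unfolding sum_lessThan_telescope[of "\<lambda>m. C j m x"] by simp
  then show ?thesis unfolding Phi_def by (simp add: convergent_LIMSEQ_iff)
qed

lemma Phi_in_cube: assumes "x \<in> cube j k" shows "Phi j x \<in> cube j k"
proof -
  have "(\<lambda>m. real N ^ j * infnorm (C j m x - center j k)) \<longlonglongrightarrow> real N ^ j * infnorm (Phi j x - center j k)"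
    by (intro tendsto_intros C_tendsto)
  then show ?thesis unfolding cube_iff
    by (rule LIMSEQ_le_const2) (use C_in_cube[OF assms] cube_iff in blast)
qed

text \<open>The maps of generation \<open>j + n\<close> and beyond keep both points in cube
  \<open>k\<close>, so the Lipschitz bound for the \<open>n\<close> coarser maps is uniform in
  \<open>m\<close> and passes to the limit.\<close>

lemma Phi_osc:
  assumes "u \<in> cube (j + n) k" "v \<in> cube (j + n) k"
  shows "infnorm (Phi j u - Phi j v) \<le> wt (j + n) k / wt j ((par ^^ n) k) / real N ^ (j + n)"
proof -
  have "(\<lambda>m. infnorm (C j m u - C j m v)) \<longlonglongrightarrow> infnorm (Phi j u - Phi j v)"
    by (intro tendsto_intros C_tendsto)
  then show ?thesis
  proof (rule LIMSEQ_le_const2, intro exI allI impI)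
    fix m assume m: "j + n \<le> m"
    let ?u = "C (j + n) m u" and ?v = "C (j + n) m v"
    have uv: "?u \<in> cube (j + n) k" "?v \<in> cube (j + n) k" using assms by (auto intro: C_in_cube)
    have "infnorm (C j m u - C j m v) = infnorm (C j (j + n) ?u - C j (j + n) ?v)"
      using m by (simp add: C_split[of j "j + n" m])
    also have "\<dots> \<le> wt (j + n) k / wt j ((par ^^ n) k) * infnorm (?u - ?v)"
      by (rule C_lipschitz[OF uv])
    also have "\<dots> \<le> wt (j + n) k / wt j ((par ^^ n) k) * (1 / real N ^ (j + n))"
      by (intro mult_left_mono cube_diam[OF uv]) (simp add: wt_pos less_imp_le)
    finally show "infnorm (C j m u - C j m v) \<le> wt (j + n) k / wt j ((par ^^ n) k) / real N ^ (j + n)"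
      by simp
  qed
qed

section \<open>Bump functions that separate a cube from the cubes not touching it\<close>

definition tent :: "nat \<Rightarrow> ('n \<Rightarrow> int) \<Rightarrow> real ^ 'n \<Rightarrow> real" where
  "tent j k y = max 0 (min 1 (3/2 - real N ^ j * infnorm (y - center j k)))"

lemma tent_lipschitz: "\<bar>tent j k u - tent j k v\<bar> \<le> real N ^ j * infnorm (u - v)"
proof -
  have "\<bar>tent j k u - tent j k v\<bar> \<le> \<bar>real N ^ j * infnorm (u - center j k) - real N ^ j * infnorm (v - center j k)\<bar>"
    unfolding tent_def by linarith
  also have "\<dots> = real N ^ j * \<bar>infnorm (u - center j k) - infnorm (v - center j k)\<bar>"
    by (simp add: abs_mult flip: right_diff_distrib)
  also have "\<dots> \<le> real N ^ j * infnorm (u - v)"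
    using absdiff_infnorm[of "u - center j k" "v - center j k"] by (intro mult_left_mono) auto
  finally show ?thesis .
qed

text \<open>\<open>tent\<close> is \<open>1\<close> on the cube and \<open>0\<close> from scaled
  radius \<open>3/2\<close> on. As \<open>Phi j\<close> preserves every generation-\<open>j\<close>
  cube, both properties survive the composition: \<open>phi\<close> is \<open>1\<close> on the cube
  and \<open>0\<close> on cubes not adjacent to it.\<close>

definition phi :: "nat \<Rightarrow> ('n \<Rightarrow> int) \<Rightarrow> real ^ 'n \<Rightarrow> real" where
  "phi j k x = tent j k (Phi j x)"

lemma phi_range: "0 \<le> phi j k x" "phi j k x \<le> 1"
  by (auto simp: phi_def tent_def)

lemma phi_diff_le_1: "\<bar>phi j k x - phi j k y\<bar> \<le> 1"
  using phi_range[of j k x] phi_range[of j k y] by linarith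

lemma phi_one: "phi j (idx j x) x = 1"
  using Phi_in_cube[OF cube_idx[of x j]] by (simp add: phi_def tent_def cube_iff)

lemma phi_zero: assumes "\<not> adj (idx j x) k" shows "phi j k x = 0"
proof -
  define y where "y = Phi j x"
  obtain i where i: "\<bar>idx j x i - k i\<bar> \<ge> 2" proof -
    obtain i where "\<not> \<bar>idx j x i - k i\<bar> \<le> 1" using assms by (auto simp: adj_def)
    then show thesis by (intro that[of i]) linarith
  qed
  have "y \<in> cube j (idx j x)" unfolding y_def by (rule Phi_in_cube[OF cube_idx])
  then have "of_int (idx j x i) \<le> real N ^ j * y $ i" "real N ^ j * y $ i \<le> of_int (idx j x i) + 1"
    by (auto simp: cube_def)
  moreover have "\<bar>real_of_int (idx j x i) - of_int (k i)\<bar> \<ge> 2" using i by linarith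
  ultimately have "\<bar>real N ^ j * y $ i - (of_int (k i) + 1/2)\<bar> \<ge> 3/2" by linarith
  then show ?thesis using scaled_ge[of j y i k] by (simp add: phi_def tent_def flip: y_def)
qed

lemma phi_osc:
  assumes "u \<in> cube (j + n) l" "v \<in> cube (j + n) l"
  shows "\<bar>phi j k u - phi j k v\<bar> \<le> wt (j + n) l / wt j ((par ^^ n) l) / real N ^ n"
proof -
  have "\<bar>phi j k u - phi j k v\<bar> \<le> real N ^ j * infnorm (Phi j u - Phi j v)"
    unfolding phi_def by (rule tent_lipschitz)
  also have "\<dots> \<le> real N ^ j * (wt (j + n) l / wt j ((par ^^ n) l) / real N ^ (j + n))"
    by (intro mult_left_mono Phi_osc assms) auto
  also have "\<dots> = wt (j + n) l / wt j ((par ^^ n) l) / real N ^ n"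
    using Npos by (simp add: power_add)
  finally show ?thesis .
qed

text \<open>Lets oscillation bounds be chained from a cube to its neighbour; the witness is the
  coordinatewise maximum of the two lower corners.\<close>

lemma adj_cubes_touch: assumes "adj a b" shows "\<exists>z. z \<in> cube m a \<and> z \<in> cube m b"
proof (intro exI conjI)
  let ?z = "\<chi> i. of_int (max (a i) (b i)) / real N ^ m"
  have z: "real N ^ m * ?z $ i = of_int (max (a i) (b i))" for i
    using NNpos[of m] by (simp del: NNpos)
  have ab: "max (a i) (b i) \<le> a i + 1" "max (a i) (b i) \<le> b i + 1" for i
    using assms[unfolded adj_def, rule_format, of i] by auto
  show "?z \<in> cube m a" "?z \<in> cube m b"
    unfolding cube_def mem_Collect_eq z
    using ab[THEN of_int_le_iff[where 'a = real, THEN iffD2]]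
    by (simp_all only: of_int_le_iff max.cobounded1 max.cobounded2 of_int_add of_int_1 simp_thms)
qed

section \<open>Sizes across generations and the upper bound for a single test function\<close>

lemma sz_anc: "sz (l + n) k \<le> (K / N) ^ n * sz l ((par ^^ n) k)"
proof (induction n arbitrary: k)
  case (Suc n)
  have "sz (l + Suc n) k \<le> K / N * sz (l + n) (par k)" using sz_step(2)[of "l + n" k] by simp
  also have "\<dots> \<le> K / N * ((K / N) ^ n * sz l ((par ^^ n) (par k)))"
    using K_bounds Npos by (intro mult_left_mono Suc.IH) auto
  finally show ?case by (simp add: funpow_swap1)
qed simp

lemma sz_anc_ge: "(q / N) ^ n * sz l ((par ^^ n) k) \<le> sz (l + n) k"
proof (induction n arbitrary: k)
  case (Suc n)
  have "(q / N) ^ Suc n * sz l ((par ^^ Suc n) k) = q / N * ((q / N) ^ n * sz l ((par ^^ n) (par k)))"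
    by (simp add: funpow_swap1)
  also have "\<dots> \<le> q / N * sz (l + n) (par k)"
    using q Npos by (intro mult_left_mono Suc.IH) auto
  also have "\<dots> \<le> sz (l + Suc n) k" using sz_step(1)[of "l + n" k] by simp
  finally show ?case .
qed simp

lemma sz_idx_le: "sz (l + n) (idx (l + n) x) \<le> (K / N) ^ n * sz l (idx l x)"
  and sz_idx_ge: "(q / N) ^ n * sz l (idx l x) \<le> sz (l + n) (idx (l + n) x)"
  using sz_anc[of l n "idx (l + n) x"] sz_anc_ge[of n l "idx (l + n) x"] by (simp_all add: idx_anc)

lemma adj_idx: assumes "infnorm (u - v) \<le> 1 / real N ^ l" shows "adj (idx l u) (idx l v)"
  unfolding adj_def
proof
  fix i
  have "real N ^ l * \<bar>(u - v) $ i\<bar> \<le> real N ^ l * (1 / real N ^ l)"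
    using assms infnorm_ge_cart[of "u - v" i] by (intro mult_left_mono) auto
  then have "\<bar>real N ^ l * u $ i - real N ^ l * v $ i\<bar> \<le> 1"
    using Npos by (simp add: abs_mult flip: right_diff_distrib)
  then show "\<bar>idx l u i - idx l v i\<bar> \<le> 1" unfolding idx_def by linarith
qed

text \<open>The comparability constant of adjacent cubes from \<open>adj_wt\<close>.\<close>

definition M :: real where "M = K / q"

lemma M_ge_1: "1 \<le> M" using K_bounds q by (simp add: M_def)

text \<open>A test function of coarser generation oscillates on the cubes of \<open>u\<close> and
  \<open>v\<close> by at most their relative sizes, which the prefactor \<open>sz j k\<close> turns
  into absolute sizes. For a finer one the prefactor alone suffices, because sizes decrease along
  descendants.\<close>

lemma phi_upper:
  assumes "infnorm (u - v) \<le> 1 / real N ^ l"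
  shows "sz j k * \<bar>phi j k u - phi j k v\<bar> \<le> 2 * M ^ 3 * sz l (idx l u)"
proof (cases "adj (idx j u) k \<or> adj (idx j v) k")
  case False
  then show ?thesis using sz_pos[of l "idx l u"] M_ge_1 by (simp add: phi_zero)
next
  case True
  note adj_l = adj_idx[OF assms]
  have M0: "0 < M" using M_ge_1 by simp
  have M3: "M ^ 2 \<le> M ^ 3" using M_ge_1 by (intro power_increasing) auto
  consider n where "l = j + n" | n where "j = l + n" using nat_le_linear le_Suc_ex by metis
  then show ?thesis
  proof cases
    case (1 n)
    let ?a = "idx l u" and ?b = "idx l v" and ?A = "idx j u" and ?A' = "idx j v"
    have "adj ((par ^^ n) ?a) ((par ^^ n) ?b)" 
      using adj_l by (induction n) (auto intro: adj_par)
    then have adj_j: "adj ?A ?A'" by (simp add: 1 idx_anc)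
    \<comment> \<open>Cube \<open>k\<close> is adjacent to the cube of \<open>u\<close> or of
      \<open>v\<close>, and these two are adjacent to each other, so at most two comparisons by
      \<open>M\<close> are needed.\<close>
    have kA: "wt j k \<le> M ^ 2 * wt j ?A" "wt j k \<le> M ^ 2 * wt j ?A'"
    proof -
      have *: "wt j k \<le> M ^ 2 * wt j x" "wt j k \<le> M ^ 2 * wt j y"
        if "adj k x" "adj x y" for x y :: "'a \<Rightarrow> int"
      proof -
        have 1: "wt j k \<le> M * wt j x" using adj_wt[OF that(1)] by (simp add: M_def)
        have "wt j x \<le> M * wt j y" using adj_wt[OF that(2)] by (simp add: M_def)
        then have "M * wt j x \<le> M * (M * wt j y)" by (intro mult_left_mono) (use M0 in auto)
        with 1 show "wt j k \<le> M ^ 2 * wt j y" by (simp add: power2_eq_square)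
        have "1 * (M * wt j x) \<le> M * (M * wt j x)"
          using M_ge_1 wt_pos[of j x] by (intro mult_right_mono) auto
        with 1 show "wt j k \<le> M ^ 2 * wt j x" by (simp add: power2_eq_square)
      qed
      show "wt j k \<le> M ^ 2 * wt j ?A" "wt j k \<le> M ^ 2 * wt j ?A'"
        using True *[of ?A ?A'] *[of ?A' ?A] adj_j adj_sym by blast+
    qed
    obtain z where z: "z \<in> cube l ?a" "z \<in> cube l ?b" using adj_cubes_touch[OF adj_l] by blast
    have zu: "\<bar>phi j k u - phi j k z\<bar> \<le> wt l ?a / wt j ?A / real N ^ n"
      using phi_osc[of u j n ?a z k] z cube_idx[of u l] idx_anc[of n j u] 1 by simp
    have zv: "\<bar>phi j k z - phi j k v\<bar> \<le> wt l ?b / wt j ?A' / real N ^ n"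
      using phi_osc[of z j n ?b v k] z cube_idx[of v l] idx_anc[of n j v] 1 by simp
    have *: "sz j k * (wt l c / wt j D / real N ^ n) \<le> M ^ 2 * sz l c"
      if "wt j k \<le> M ^ 2 * wt j D" for c D :: "'a \<Rightarrow> int"
    proof -
      have "sz j k * (wt l c / wt j D / real N ^ n) = wt j k * (wt l c / wt j D / real N ^ l)"
        by (simp add: sz_def 1 power_add)
      also have "\<dots> \<le> M ^ 2 * wt j D * (wt l c / wt j D / real N ^ l)"
        using that by (intro mult_right_mono) (auto simp: wt_pos less_imp_le)
      also have "\<dots> = M ^ 2 * sz l c" using wt_pos[of j D] by (simp add: sz_def)
      finally show ?thesis .
    qed
    have "sz j k * \<bar>phi j k u - phi j k v\<bar> \<le> sz j k * (wt l ?a / wt j ?A / real N ^ n + wt l ?b / wt j ?A' / real N ^ n)"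
      using zu zv sz_pos[of j k] by (intro mult_left_mono) auto
    also have "\<dots> \<le> M ^ 2 * sz l ?a + M ^ 2 * sz l ?b"
      using *[OF kA(1), of ?a] *[OF kA(2), of ?b] by (simp add: distrib_left)
    also have "M ^ 2 * sz l ?b \<le> M ^ 2 * (M * sz l ?a)"
      using adj_sz[OF adj_sym[OF adj_l], of l] M0 by (intro mult_left_mono) (auto simp: M_def)
    also have "M ^ 2 * sz l ?a \<le> M ^ 3 * sz l ?a"
      using M3 sz_pos[of l ?a] by (intro mult_right_mono) auto
    finally show ?thesis by (simp add: power2_eq_square power3_eq_cube)
  next
    case (2 n)
    have *: "sz j k \<le> M * sz l (idx l w)" if "adj (idx j w) k" for w
    proof -
      have "sz j k \<le> M * sz j (idx j w)"
        using adj_sz[OF adj_sym[OF that]] by (simp add: M_def)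
      also have "sz j (idx j w) \<le> (K / N) ^ n * sz l (idx l w)" using sz_idx_le[of l n w] 2 by simp
      also have "\<dots> \<le> 1 * sz l (idx l w)"
        using K_bounds Npos sz_pos[of l "idx l w"] by (intro mult_right_mono power_le_one) auto
      finally show ?thesis using M0 by simp
    qed
    have uv: "sz l (idx l v) \<le> M * sz l (idx l u)"
      using adj_sz[OF adj_sym[OF adj_l], of l] by (simp add: M_def)
    have "sz j k \<le> M ^ 2 * sz l (idx l u)"
    proof (cases "adj (idx j u) k")
      case True
      have "1 * (M * sz l (idx l u)) \<le> M * (M * sz l (idx l u))"
        using M_ge_1 sz_pos[of l "idx l u"] by (intro mult_right_mono) auto
      then show ?thesis using *[OF True] by (simp add: power2_eq_square)
    next
      case False
      then have "sz j k \<le> M * sz l (idx l v)" using * True by blast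
      also have "\<dots> \<le> M * (M * sz l (idx l u))" using uv M0 by (intro mult_left_mono) auto
      finally show ?thesis by (simp add: power2_eq_square)
    qed
    also have "\<dots> \<le> 2 * M ^ 3 * sz l (idx l u)"
      using M3 sz_pos[of l "idx l u"] zero_less_power[OF M0, of 3] by (intro mult_right_mono) linarith+
    finally have "sz j k \<le> 2 * M ^ 3 * sz l (idx l u)" .
    moreover have "sz j k * \<bar>phi j k u - phi j k v\<bar> \<le> sz j k * 1"
      using sz_pos[of j k] phi_diff_le_1 by (intro mult_left_mono) auto
    ultimately show ?thesis by simp
  qed
qed

section \<open>The metric and its quasisymmetry\<close>

definition dist_term :: "real ^ 'n \<Rightarrow> real ^ 'n \<Rightarrow> nat \<times> ('n \<Rightarrow> int) \<Rightarrow> real" where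
  "dist_term x y p = sz (fst p) (snd p) * \<bar>phi (fst p) (snd p) x - phi (fst p) (snd p) y\<bar>"

definition cdist :: "real ^ 'n \<Rightarrow> real ^ 'n \<Rightarrow> real" where
  "cdist x y = (SUP p. dist_term x y p)"

lemma sz_le: "sz j k \<le> B * K / real N ^ j"
  unfolding sz_def by (intro divide_right_mono wt_le) auto

lemma sz_le_BK: "sz j k \<le> B * K"
proof -
  have "1 \<le> real N ^ j" using Npos by (intro one_le_power) auto
  then have "B * K / real N ^ j \<le> B * K / 1"
    using B K_bounds by (intro divide_left_mono) auto
  then show ?thesis using sz_le[of j k] by linarith
qed

lemma dist_term_bdd: "bdd_above (range (dist_term x y))"
proof (rule bdd_aboveI2)
  fix p
  show "dist_term x y p \<le> B * K * 1"
    unfolding dist_term_def using B K_bounds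
    by (intro mult_mono sz_le_BK phi_diff_le_1) auto
qed

lemma dist_term_le: "dist_term x y p \<le> cdist x y"
  unfolding cdist_def by (rule cSUP_upper[OF UNIV_I dist_term_bdd])

lemma cdist_le: "(\<And>p. dist_term x y p \<le> c) \<Longrightarrow> cdist x y \<le> c"
  unfolding cdist_def by (intro cSUP_least) auto

lemma cdist_upper:
  "infnorm (u - v) \<le> 1 / real N ^ l \<Longrightarrow> cdist u v \<le> 2 * M ^ 3 * sz l (idx l u)"
  by (rule cdist_le) (simp add: dist_term_def phi_upper)

text \<open>In some coordinate the indices of \<open>u\<close> and \<open>v\<close> differ by at
  least \<open>2\<close>, so the bump of the cube of \<open>u\<close> is \<open>1\<close> at
  \<open>u\<close> and \<open>0\<close> at \<open>v\<close>.\<close>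

lemma cdist_lower:
  assumes "2 / real N ^ l < infnorm (u - v)"
  shows "sz l (idx l u) \<le> cdist u v"
proof -
  obtain i where i: "2 / real N ^ l < \<bar>(u - v) $ i\<bar>"
    using assms infnorm_le_iff_cart[of "u - v" "2 / real N ^ l"] by (auto simp: not_le)
  then have "2 < real N ^ l * \<bar>(u - v) $ i\<bar>"
    using NNpos[of l] by (simp add: pos_divide_less_eq mult.commute del: NNpos)
  then have "2 < \<bar>real N ^ l * u $ i - real N ^ l * v $ i\<bar>"
    by (simp add: abs_mult flip: right_diff_distrib)
  then have "\<not> \<bar>idx l v i - idx l u i\<bar> \<le> 1" unfolding idx_def by linarith
  then have "\<not> adj (idx l v) (idx l u)" by (auto simp: adj_def)
  then have "dist_term u v (l, idx l u) = sz l (idx l u)"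
    by (simp add: dist_term_def phi_zero phi_one)
  then show ?thesis using dist_term_le[of u v "(l, idx l u)"] by simp
qed

lemma cdist_level_lower:
  assumes "1 / real N ^ Suc l < infnorm (u - v)"
  shows "(q / N)\<^sup>2 * sz l (idx l u) \<le> cdist u v"
proof -
  \<comment> \<open>Going two generations down from \<open>l\<close> meets the factor
    \<open>2\<close> required by \<open>cdist_lower\<close> and costs at most the factor
    \<open>(q / N)\<^sup>2\<close> in size.\<close>
  have "2 / real N ^ (l + 2) \<le> 1 / real N ^ Suc l" using N8 by (simp add: field_simps)
  then have "sz (l + 2) (idx (l + 2) u) \<le> cdist u v" using assms by (intro cdist_lower) linarith
  then show ?thesis using sz_idx_ge[of 2 l u] by linarith
qed

lemma Metric_space_cdist: "Metric_space S (cdist :: real ^ 'n \<Rightarrow> real ^ 'n \<Rightarrow> real)"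
proof
  fix x y z :: "real ^ 'n"
  show nn: "0 \<le> cdist x y"
    using dist_term_le[of x y "(0, \<lambda>_. 0)"] sz_pos[of 0 "\<lambda>_. 0 :: int"]
    by (auto simp: dist_term_def sz_def intro: order_trans[rotated])
  show "cdist x y = cdist y x"
    unfolding cdist_def dist_term_def by (simp add: abs_minus_commute)
  show "cdist x y = 0 \<longleftrightarrow> x = y"
  proof
    assume "x = y"
    moreover have "cdist y y \<le> 0" by (rule cdist_le) (simp add: dist_term_def)
    ultimately show "cdist x y = 0" using nn by simp
  next
    assume d0: "cdist x y = 0"
    show "x = y"
    proof (rule ccontr)
      assume "x \<noteq> y"
      then have "0 < infnorm (x - y) / 2" by (simp add: infnorm_pos_lt)
      then obtain l where "(1 / real N) ^ l < infnorm (x - y) / 2"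
        using real_arch_pow_inv[of "infnorm (x - y) / 2" "1 / real N"] Npos by auto
      then have "sz l (idx l x) \<le> cdist x y"
        by (intro cdist_lower) (simp add: power_one_over)
      then show False using sz_pos[of l "idx l x"] d0 by linarith
    qed
  qed
  show "cdist x z \<le> cdist x y + cdist y z"
  proof (rule cdist_le)
    fix p
    have "dist_term x z p \<le> sz (fst p) (snd p) * (\<bar>phi (fst p) (snd p) x - phi (fst p) (snd p) y\<bar>
        + \<bar>phi (fst p) (snd p) y - phi (fst p) (snd p) z\<bar>)"
      unfolding dist_term_def by (intro mult_left_mono) (auto intro: less_imp_le[OF sz_pos])
    also have "\<dots> = dist_term x y p + dist_term y z p" by (simp add: dist_term_def distrib_left)
    also have "\<dots> \<le> cdist x y + cdist y z" by (intro add_mono dist_term_le)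
    finally show "dist_term x z p \<le> cdist x y + cdist y z" .
  qed
qed

text \<open>The last factor \<open>N\<close> pays for rounding a separation up to a power of
  \<open>1 / N\<close>; the others come from \<open>cdist_upper\<close> and
  \<open>sz_le\<close>.\<close>

definition Lip :: real where "Lip = 2 * M ^ 3 * B * K * N"

lemma Lip_pos: "0 < Lip" using M_ge_1 B K_bounds Npos by (simp add: Lip_def)

lemma cdist_lipschitz: assumes "infnorm (u - v) \<le> 1" shows "cdist u v \<le> Lip * infnorm (u - v)"
proof (cases "u = v")
  case True
  then show ?thesis by (simp add: infnorm_0 Metric_space.mdist_zero[OF Metric_space_cdist[of UNIV]])
next
  case False
  then have "0 < infnorm (u - v)" by (simp add: infnorm_pos_lt)
  then obtain l where l: "1 / real N ^ Suc l < infnorm (u - v)" "infnorm (u - v) \<le> 1 / real N ^ l"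
    using power_level_exists[OF Npos(3)] assms by blast
  have "cdist u v \<le> 2 * M ^ 3 * sz l (idx l u)" by (rule cdist_upper[OF l(2)])
  also have "\<dots> \<le> 2 * M ^ 3 * (B * K / real N ^ l)"
    using M_ge_1 by (intro mult_left_mono sz_le) auto
  also have "\<dots> = Lip * (1 / real N ^ Suc l)" using Npos by (simp add: Lip_def)
  also have "\<dots> \<le> Lip * infnorm (u - v)" using l Lip_pos by (intro mult_left_mono) auto
  finally show ?thesis .
qed

lemma infnorm_cbox: assumes "u \<in> cbox 0 (1 :: real ^ 'n)" "v \<in> cbox 0 1" shows "infnorm (u - v) \<le> 1"
  unfolding infnorm_le_iff_cart
proof
  fix i
  have "0 \<le> u $ i" "u $ i \<le> 1" "0 \<le> v $ i" "v $ i \<le> 1" using assms by (auto simp: mem_box_cart)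
  then show "\<bar>(u - v) $ i\<bar> \<le> 1" by simp
qed

lemma cdist_topology:
  "Metric_space.mtopology (cbox 0 (1 :: real ^ 'n)) cdist = Metric_space.mtopology (cbox 0 1) dist"
proof (rule mtopology_cong_uniform)
  let ?S = "sqrt (real DIM(real ^ 'n))"
  have S: "0 < ?S" by simp
  show "Metric_space (cbox 0 (1 :: real ^ 'n)) cdist" by (rule Metric_space_cdist)
  show "Metric_space (cbox 0 (1 :: real ^ 'n)) dist" by unfold_locales (auto simp: dist_commute dist_triangle)
  fix e :: real assume e: "0 < e"
  then have "0 < e / (2 * ?S)" using S by simp
  then obtain l where "(1 / real N) ^ l < e / (2 * ?S)"
    using real_arch_pow_inv[of "e / (2 * ?S)" "1 / real N"] Npos by auto
  then have l: "?S * (2 / real N ^ l) < e" using S by (simp add: field_simps)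
  show "\<exists>r>0. \<forall>x\<in>cbox 0 (1 :: real ^ 'n). \<forall>y\<in>cbox 0 1. cdist x y < r \<longrightarrow> dist x y < e"
  \<comment> \<open>By \<open>wt_ge\<close> every generation-\<open>l\<close> cube has at least this
    size, so a smaller \<open>cdist\<close> excludes a separation above
    \<open>2 / N ^ l\<close>.\<close>
  proof (intro exI[of _ "q ^ l / real N ^ l"] conjI ballI impI)
    show "0 < q ^ l / real N ^ l" using q by (intro divide_pos_pos NNpos) simp
    fix x y :: "real ^ 'n" assume "cdist x y < q ^ l / real N ^ l"
    also have "\<dots> \<le> sz l (idx l x)" unfolding sz_def by (intro divide_right_mono wt_ge) auto
    finally have "infnorm (x - y) \<le> 2 / real N ^ l" using cdist_lower[of l x y] by linarith
    then have "?S * infnorm (x - y) \<le> ?S * (2 / real N ^ l)" by (intro mult_left_mono) auto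
    then show "dist x y < e" using l norm_le_infnorm[of "x - y"] by (simp add: dist_norm)
  qed
  show "\<exists>r>0. \<forall>x\<in>cbox 0 (1 :: real ^ 'n). \<forall>y\<in>cbox 0 1. dist x y < r \<longrightarrow> cdist x y < e"
  proof (intro exI[of _ "e / Lip"] conjI ballI impI)
    show "0 < e / Lip" using e Lip_pos by simp
    fix x y :: "real ^ 'n" assume xy: "x \<in> cbox 0 1" "y \<in> cbox 0 1" "dist x y < e / Lip"
    have "cdist x y \<le> Lip * infnorm (x - y)" by (intro cdist_lipschitz infnorm_cbox xy)
    also have "\<dots> \<le> Lip * dist x y"
      using Lip_pos infnorm_le_norm[of "x - y"] by (intro mult_left_mono) (auto simp: dist_norm)
    also have "\<dots> < e" using xy(3) Lip_pos by (simp add: field_simps)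
    finally show "cdist x y < e" .
  qed
qed

text \<open>Both distances are comparable to sizes of cubes around the common point
  \<open>x\<close>. Over \<open>n\<close> generations these sizes shrink by a factor between
  \<open>(q / N) ^ n\<close> and \<open>(K / N) ^ n\<close>, which bounds their quotient by powers
  of the quotient of separations.\<close>

lemma cdist_quasisymmetric:
  "quasisymmetric_homeomorphism (cbox 0 (1 :: real ^ 'n)) dist (cbox 0 1) cdist (\<lambda>x. x)"
  unfolding quasisymmetric_homeomorphism_def
proof
  have "homeomorphic_map (Metric_space.mtopology (cbox 0 (1 :: real ^ 'n)) dist)
     (Metric_space.mtopology (cbox 0 1) cdist) id"
    by (simp add: cdist_topology homeomorphic_map_id)
  then show "homeomorphic_map (Metric_space.mtopology (cbox 0 (1 :: real ^ 'n)) dist)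
     (Metric_space.mtopology (cbox 0 1) cdist) (\<lambda>x. x)" by (simp add: id_def)
  let ?S = "sqrt (real DIM(real ^ 'n))"
  have S: "0 < ?S" by simp
  \<comment> \<open>The exponents are chosen so that \<open>N powr a = N / K\<close> and
    \<open>N powr b = N / q\<close>, the extreme shrinking rates per generation.\<close>
  define a b where "a = ln (N / K) / ln N" and "b = ln (N / q) / ln N"
  have lnN: "0 < ln (real N)" using Npos by simp
  have a: "0 < a" unfolding a_def using K_bounds lnN by (intro divide_pos_pos) auto
  have "q < real N" using q Npos by linarith
  then have b: "0 < b" unfolding b_def using q lnN by (intro divide_pos_pos) auto
  have Na: "real N powr a = N / K"
    unfolding a_def powr_def using K_bounds Npos lnN by (simp add: exp_ln)
  have Nb: "real N powr b = N / q"
    unfolding b_def powr_def using q Npos lnN by (simp add: exp_ln)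
  \<comment> \<open>The quotient of the constants in \<open>cdist_upper\<close> and
    \<open>cdist_level_lower\<close>.\<close>
  define A0 where "A0 = 2 * M ^ 3 * (N / q)\<^sup>2"
  have A0: "0 < A0" using M_ge_1 q Npos by (simp add: A0_def)
  \<comment> \<open>\<open>N\<close> absorbs one generation of rounding, and \<open>?S\<close> the
    passage from the sup-norm to the Euclidean norm.\<close>
  define A where "A = A0 * ((N * ?S) powr a + (N * ?S) powr b)"
  have A: "0 < A" using A0 Npos S by (simp add: A_def add_pos_pos)
  have "cdist x y / cdist x z \<le> A * ((dist x y / dist x z) powr a + (dist x y / dist x z) powr b)"
    if xyz: "x \<in> cbox 0 1" "y \<in> cbox 0 1" "z \<in> cbox 0 1" "x \<noteq> y" "x \<noteq> z" for x y z :: "real ^ 'n"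
  proof -
    define t1 t2 where t: "t1 = infnorm (x - y)" "t2 = infnorm (x - z)"
    have t01: "0 < t1" "t1 \<le> 1" "0 < t2" "t2 \<le> 1"
      using xyz by (auto simp: t infnorm_pos_lt infnorm_cbox)
    obtain l where l: "1 / real N ^ Suc l < t1" "t1 \<le> 1 / real N ^ l"
      using power_level_exists[OF Npos(3) t01(1,2)] by blast
    obtain l' where l': "1 / real N ^ Suc l' < t2" "t2 \<le> 1 / real N ^ l'"
      using power_level_exists[OF Npos(3) t01(3,4)] by blast
    let ?s = "sz l (idx l x)" and ?s' = "sz l' (idx l' x)"
    have s: "0 < ?s" "0 < ?s'" by (rule sz_pos)+
    have "cdist x y / cdist x z \<le> (2 * M ^ 3 * ?s) / ((q / N)\<^sup>2 * ?s')"
      using cdist_upper[of x y l] cdist_level_lower[of l' x z] l l' s q Npos M_ge_1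
      by (intro frac_le) (auto simp: t)
    also have "\<dots> = A0 * (?s / ?s')" by (simp add: A0_def power_divide)
    finally have 1: "cdist x y / cdist x z \<le> A0 * (?s / ?s')" .
    define \<rho> where "\<rho> = dist x y / dist x z"
    have \<rho>: "0 \<le> \<rho>" by (simp add: \<rho>_def)
    have "t1 / t2 \<le> dist x y / (dist x z / ?S)"
      using infnorm_le_norm[of "x - y"] norm_le_infnorm[of "x - z"] xyz S t01
      by (intro frac_le) (auto simp: t dist_norm field_simps)
    then have tr: "t1 / t2 \<le> ?S * \<rho>" by (simp add: \<rho>_def mult.commute)
    have "?s / ?s' \<le> (N * (t1 / t2)) powr a + (N * (t1 / t2)) powr b"
    proof -
      \<comment> \<open>In the first case \<open>y\<close> is, up to rounding, no farther from
        \<open>x\<close> than \<open>z\<close>, and the upper shrinking rate gives the power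
        \<open>a\<close>; in the second the lower rate gives the power \<open>b\<close>.\<close>
      consider n where "l = l' + n" | n where "l' = l + n" using nat_le_linear le_Suc_ex by metis
      then show ?thesis
      proof cases
        case (1 n)
        have "?s / ?s' \<le> (K / N) ^ n"
          using sz_idx_le[of l' n x] s 1 by (simp add: pos_divide_le_eq)
        also have "\<dots> = (1 / real N powr a) ^ n" using Na by simp
        also have "\<dots> = (1 / real N ^ n) powr a"
          using Npos by (simp add: powr_divide powr_power power_one_over powr_realpow[symmetric] powr_powr mult.commute)
        also have "\<dots> \<le> (N * (t1 / t2)) powr a"
        proof (rule powr_mono2)
          have "(1 / real N ^ Suc l) / (1 / real N ^ l') \<le> t1 / t2"
            using l l' t01 by (intro frac_le) auto
          then have "N * ((1 / real N ^ Suc l) / (1 / real N ^ l')) \<le> N * (t1 / t2)"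
            by (intro mult_left_mono) auto
          then show "1 / real N ^ n \<le> N * (t1 / t2)" using Npos by (simp add: 1 power_add)
        qed (use a in auto)
        finally show ?thesis by (meson add_increasing2 powr_ge_zero)
      next
        case (2 n)
        have "?s / ?s' \<le> ?s / ((q / N) ^ n * ?s)"
          using sz_idx_ge[of n l x] s q Npos 2 by (intro divide_left_mono) auto
        also have "\<dots> = (N / q) ^ n" using s q Npos by (simp add: power_divide)
        also have "\<dots> = (real N ^ n) powr b"
          using Npos by (simp add: powr_power powr_realpow[symmetric] powr_powr mult.commute flip: Nb)
        also have "\<dots> \<le> (N * (t1 / t2)) powr b"
        proof (rule powr_mono2)
          have "(1 / real N ^ Suc l) / (1 / real N ^ l') \<le> t1 / t2"
            using l l' t01 by (intro frac_le) auto
          then have "N * ((1 / real N ^ Suc l) / (1 / real N ^ l')) \<le> N * (t1 / t2)"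
            by (intro mult_left_mono) auto
          then show "real N ^ n \<le> N * (t1 / t2)" using Npos by (simp add: 2 power_add)
        qed (use b in auto)
        finally show ?thesis by (meson add_increasing powr_ge_zero)
      qed
    qed
    also have "\<dots> \<le> (N * ?S * \<rho>) powr a + (N * ?S * \<rho>) powr b"
    proof -
      have "N * (t1 / t2) \<le> N * ?S * \<rho>"
        unfolding mult.assoc using tr by (intro mult_left_mono) auto
      then show ?thesis using t01 a b by (intro add_mono powr_mono2) auto
    qed
    also have "\<dots> = (N * ?S) powr a * \<rho> powr a + (N * ?S) powr b * \<rho> powr b"
      using S \<rho> by (simp add: powr_mult)
    also have "\<dots> \<le> ((N * ?S) powr a + (N * ?S) powr b) * (\<rho> powr a + \<rho> powr b)"
      by (simp add: algebra_simps)
    finally have "A0 * (?s / ?s') \<le> A0 * (((N * ?S) powr a + (N * ?S) powr b) * (\<rho> powr a + \<rho> powr b))"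
      using A0 by (intro mult_left_mono) auto
    then show ?thesis using 1 by (simp add: A_def \<rho>_def mult.assoc)
  qed
  then show "\<exists>\<eta> \<eta>'. homeomorphism {0..} {0..} \<eta> \<eta>' \<and>
        (\<forall>x\<in>cbox 0 1. \<forall>y\<in>cbox 0 1. \<forall>z\<in>cbox 0 (1 :: real ^ 'n). x \<noteq> y \<and> y \<noteq> z \<and> x \<noteq> z \<longrightarrow>
           cdist x y / cdist x z \<le> \<eta> (dist x y / dist x z))"
    using sum_powr_homeomorphism[OF a b A] by blast
qed

section \<open>Hausdorff measure and dimension\<close>

text \<open>The extra index in each direction is for coordinates equal to \<open>1\<close>, whose
  floor index is \<open>N ^ m\<close>.\<close>

lemma idx_cbox: assumes "x \<in> cbox 0 (1 :: real ^ 'n)" shows "idx m x \<in> index_box (N ^ m + 1)"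
proof -
  have "0 \<le> idx m x i \<and> idx m x i < int (N ^ m + 1)" for i
  proof -
    have x: "0 \<le> x $ i" "x $ i \<le> 1" using assms by (auto simp: mem_box_cart)
    then have "real N ^ m * x $ i \<le> real N ^ m * 1" by (intro mult_left_mono) auto
    then have "\<lfloor>real N ^ m * x $ i\<rfloor> \<le> \<lfloor>real_of_int (int (N ^ m))\<rfloor>" by (intro floor_mono) simp
    then have "\<lfloor>real N ^ m * x $ i\<rfloor> \<le> int (N ^ m)" by (simp only: floor_of_int)
    then show ?thesis using x by (simp add: idx_def)
  qed
  then show ?thesis by (simp add: index_box_def)
qed

lemma card_index_box_le:
  "real (card (index_box (N ^ m + 1) :: ('n :: finite \<Rightarrow> int) set)) \<le> (2 * real N ^ m) ^ CARD('n)"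
proof -
  have "1 \<le> real N ^ m" using Npos by (intro one_le_power) auto
  then have "(real N ^ m + 1) ^ CARD('n) \<le> (2 * real N ^ m) ^ CARD('n)" by (intro power_mono) auto
  then show ?thesis by (simp add: card_index_box add.commute)
qed

lemma idx_eq_close: "idx m u = idx m v \<Longrightarrow> infnorm (u - v) \<le> 1 / real N ^ m"
  using cube_diam[of u m "idx m u" v] cube_idx[of u m] cube_idx[of v m] by simp

text \<open>Generation \<open>m\<close> gives at most \<open>(2 * N ^ m) ^ CARD('n)\<close> pieces
  of diameter at most \<open>Lip / N ^ m\<close>, so the powers of \<open>N\<close> cancel in the
  content.\<close>

lemma hausdorff_measure_cbox:
  "hausdorff_measure (cbox 0 1) cdist (real CARD('n)) (cbox 0 (1 :: real ^ 'n)) < \<infinity>"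
proof -
  let ?n = "CARD('n)"
  have "hausdorff_measure (cbox 0 1) cdist (real ?n) (cbox 0 (1 :: real ^ 'n)) \<le> ennreal ((2 * Lip) ^ ?n)"
    unfolding hausdorff_measure_def
  proof (rule SUP_least)
    fix \<epsilon> :: real assume "\<epsilon> \<in> {0<..}"
    then have "0 < \<epsilon> / Lip" using Lip_pos by simp
    then obtain m where "(1 / real N) ^ m < \<epsilon> / Lip"
      using real_arch_pow_inv[of "\<epsilon> / Lip" "1 / real N"] Npos by auto
    then have m: "Lip / real N ^ m \<le> \<epsilon>" using Lip_pos by (simp add: field_simps)
    let ?I = "index_box (N ^ m + 1) :: ('n \<Rightarrow> int) set" and ?r = "Lip / real N ^ m"
    have r: "0 < ?r" by (intro divide_pos_pos Lip_pos NNpos)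
    have "hausdorff_content (cbox 0 1) cdist (real ?n) \<epsilon> (cbox 0 (1 :: real ^ 'n))
       \<le> ennreal (real (card ?I) * ?r powr real ?n)"
    proof (rule hausdorff_content_le_finite[where V = "\<lambda>k. {x \<in> cbox 0 1. idx m x = k}"])
      fix k x y assume "x \<in> {x \<in> cbox 0 (1 :: real ^ 'n). idx m x = k}" "y \<in> {x \<in> cbox 0 1. idx m x = k}"
      then have xy: "x \<in> cbox 0 1" "y \<in> cbox 0 1" "infnorm (x - y) \<le> 1 / real N ^ m"
        by (auto intro: idx_eq_close)
      have "cdist x y \<le> Lip * infnorm (x - y)" by (intro cdist_lipschitz infnorm_cbox xy)
      also have "\<dots> \<le> Lip * (1 / real N ^ m)" using xy Lip_pos by (intro mult_left_mono) auto
      finally show "cdist x y \<le> ?r" by simp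
    qed (use idx_cbox m r in auto)
    also have "\<dots> \<le> ennreal ((2 * Lip) ^ ?n)"
    proof (rule ennreal_leI)
      have "real (card ?I) * ?r powr real ?n = real (card ?I) * ?r ^ ?n"
        using r by (simp add: powr_realpow)
      also have "\<dots> \<le> (2 * real N ^ m) ^ ?n * ?r ^ ?n"
        by (intro mult_right_mono card_index_box_le) (use r in auto)
      also have "\<dots> = (2 * Lip) ^ ?n"
      proof -
        have "2 * real N ^ m * ?r = 2 * Lip" using Npos by simp
        then show ?thesis by (metis power_mult_distrib)
      qed
      finally show "real (card ?I) * ?r powr real ?n \<le> (2 * Lip) ^ ?n" .
    qed
    finally show "hausdorff_content (cbox 0 1) cdist (real ?n) \<epsilon> (cbox 0 (1 :: real ^ 'n))
       \<le> ennreal ((2 * Lip) ^ ?n)" .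
  qed
  then show ?thesis by (rule le_less_trans) simp
qed

definition good :: "(real ^ 'n) set" where
  "good = {x \<in> cbox 0 1. \<forall>m. active m (idx m x)}"

text \<open>Cubes meeting \<open>good\<close> are active, so their pieces have diameter at most
  \<open>c * \<theta> ^ m\<close>. The hypothesis on \<open>lam\<close> cancels the number of cubes,
  and what remains is \<open>D * \<kappa> ^ m\<close>, which tends to \<open>0\<close>.\<close>

lemma hausdorff_dimension_good:
  assumes \<alpha>: "0 < \<alpha>" and lam\<alpha>: "lam powr \<alpha> * real N ^ CARD('n) = 1"
  shows "hausdorff_dimension (cbox 0 1) cdist (good :: (real ^ 'n) set) \<le> ennreal \<alpha>"
proof -
  let ?n = "CARD('n)"
  define c where "c = 2 * M ^ 3 * B"
  have c: "0 < c" using M_ge_1 B by (simp add: c_def)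
  define \<theta> where "\<theta> = lam / N"
  have \<theta>: "0 < \<theta>" "\<theta> < 1" using lam N8 by (auto simp: \<theta>_def)
  define D where "D = 2 ^ ?n * c powr \<alpha>"
  define \<kappa> where "\<kappa> = 1 / real N powr \<alpha>"
  have \<kappa>: "0 < \<kappa>" "\<kappa> < 1" using Npos \<alpha> by (auto simp: \<kappa>_def)
  have "hausdorff_measure (cbox 0 1) cdist \<alpha> (good :: (real ^ 'n) set) \<le> 0"
    unfolding hausdorff_measure_def
  proof (rule SUP_least)
    fix \<epsilon> :: real assume \<epsilon>: "\<epsilon> \<in> {0<..}"
    have step: "hausdorff_content (cbox 0 1) cdist \<alpha> \<epsilon> (good :: (real ^ 'n) set) \<le> ennreal (D * \<kappa> ^ m)"
      if m: "c * \<theta> ^ m \<le> \<epsilon>" for m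
    proof -
      let ?I = "index_box (N ^ m + 1) :: ('n \<Rightarrow> int) set" and ?r = "c * \<theta> ^ m"
      have r: "0 < ?r" using c \<theta> by simp
      have "hausdorff_content (cbox 0 1) cdist \<alpha> \<epsilon> (good :: (real ^ 'n) set)
         \<le> ennreal (real (card ?I) * ?r powr \<alpha>)"
      proof (rule hausdorff_content_le_finite[where V = "\<lambda>k. {x \<in> good. idx m x = k}"])
        fix k x y assume "x \<in> {x \<in> good. idx m x = k}" "y \<in> {x \<in> (good :: (real ^ 'n) set). idx m x = k}"
        then have xy: "active m (idx m x)" "infnorm (x - y) \<le> 1 / real N ^ m"
          by (auto intro: idx_eq_close simp: good_def)
        have "cdist x y \<le> 2 * M ^ 3 * sz m (idx m x)" by (rule cdist_upper[OF xy(2)])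
        also have "sz m (idx m x) \<le> B * lam ^ m / real N ^ m"
          unfolding sz_def using xy(1) by (intro divide_right_mono) (auto simp: active_def)
        finally show "cdist x y \<le> ?r"
          using M_ge_1 by (simp add: c_def \<theta>_def power_divide mult.assoc)
      qed (use idx_cbox m r \<alpha> in \<open>auto simp: good_def\<close>)
      also have "\<dots> \<le> ennreal (D * \<kappa> ^ m)"
      proof (rule ennreal_leI)
        have "\<theta> powr \<alpha> = \<kappa> / real N ^ ?n"
        proof -
          have "lam powr \<alpha> = 1 / real N ^ ?n" using lam\<alpha> Npos by (simp add: eq_divide_eq)
          then show ?thesis using lam by (simp add: \<theta>_def \<kappa>_def powr_divide)
        qed
        then have "?r powr \<alpha> = c powr \<alpha> * (\<kappa> / real N ^ ?n) ^ m"
        proof -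
          have "(\<theta> ^ m) powr \<alpha> = (\<theta> powr \<alpha>) ^ m"
            using \<theta> by (simp add: powr_realpow[symmetric] powr_powr mult.commute)
          then show ?thesis using c \<theta> \<open>\<theta> powr \<alpha> = \<kappa> / real N ^ ?n\<close> by (simp add: powr_mult)
        qed
        moreover have "real (card ?I) * (c powr \<alpha> * (\<kappa> / real N ^ ?n) ^ m)
           \<le> (2 * real N ^ m) ^ ?n * (c powr \<alpha> * (\<kappa> / real N ^ ?n) ^ m)"
          by (intro mult_right_mono card_index_box_le) (use \<kappa> in auto)
        moreover have "(2 * real N ^ m) ^ ?n * (c powr \<alpha> * (\<kappa> / real N ^ ?n) ^ m) = D * \<kappa> ^ m"
        proof -
          have "(real N ^ m) ^ ?n = (real N ^ ?n) ^ m" by (metis power_mult mult.commute)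
          then have "(2 * real N ^ m) ^ ?n = 2 ^ ?n * (real N ^ ?n) ^ m" by (simp only: power_mult_distrib)
          moreover have "(real N ^ ?n) ^ m \<noteq> 0" using Npos by simp
          ultimately show ?thesis using Npos by (simp add: D_def power_divide)
        qed
        ultimately show "real (card ?I) * ?r powr \<alpha> \<le> D * \<kappa> ^ m" by simp
      qed
      finally show ?thesis .
    qed
    have "(\<lambda>m. c * \<theta> ^ m) \<longlonglongrightarrow> c * 0" using \<theta> by (intro tendsto_intros LIMSEQ_power_zero) auto
    then have "\<forall>\<^sub>F m in sequentially. c * \<theta> ^ m < \<epsilon>" using \<epsilon> by (intro order_tendstoD) auto
    then have ev: "\<forall>\<^sub>F m in sequentially.
       hausdorff_content (cbox 0 1) cdist \<alpha> \<epsilon> (good :: (real ^ 'n) set) \<le> ennreal (D * \<kappa> ^ m)"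
      by eventually_elim (simp add: step)
    have "(\<lambda>m. ennreal (D * \<kappa> ^ m)) \<longlonglongrightarrow> ennreal (D * 0)"
      using \<kappa> by (intro tendsto_ennrealI tendsto_intros LIMSEQ_power_zero) auto
    from tendsto_lowerbound[OF this ev]
    show "hausdorff_content (cbox 0 1) cdist \<alpha> \<epsilon> (good :: (real ^ 'n) set) \<le> 0" by simp
  qed
  then have "hausdorff_measure (cbox 0 1) cdist \<alpha> (good :: (real ^ 'n) set) = 0" by simp
  then show ?thesis unfolding hausdorff_dimension_def using \<alpha> by (intro INF_lower) auto
qed

section \<open>The Lebesgue measure of the good set\<close>

text \<open>An index corresponds uniquely to its parent and its digit vector, so the sum factors;
  this drives the recursion for the moments.\<close>

lemma sum_index_box_Suc:
  fixes f h :: "('n :: finite \<Rightarrow> int) \<Rightarrow> real"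
  shows "(\<Sum>k\<in>index_box (N ^ Suc m). f (par k) * h (digit k)) =
    (\<Sum>k\<in>index_box (N ^ m). f k) * (\<Sum>d\<in>index_box N. h d)"
proof -
  have "(\<Sum>k\<in>index_box (N ^ Suc m). f (par k) * h (digit k))
     = (\<Sum>(p, d)\<in>index_box (N ^ m) \<times> index_box N. f p * h d)"
  proof (rule sum.reindex_bij_witness[where i = "\<lambda>(p, d) i. int N * p i + d i" and j = "\<lambda>k. (par k, digit k)"])
    fix k :: "'n \<Rightarrow> int" assume k: "k \<in> index_box (N ^ Suc m)"
    have "0 \<le> k i div int N \<and> k i div int N < int (N ^ m)" for i
    proof -
      have "0 \<le> k i" "k i < int (N ^ m) * int N" using k by (auto simp: index_box_def mult.commute)
      then have "int N * (k i div int N) < int N * int (N ^ m)"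
        using div_mult_frame(1)[OF Npos(2), of "k i"] by (simp only: mult.commute)
      then have "k i div int N < int (N ^ m)" using Npos by (simp only: mult_less_cancel_left_pos)
      then show ?thesis using \<open>0 \<le> k i\<close> Npos by (simp add: pos_imp_zdiv_nonneg_iff)
    qed
    then show "(par k, digit k) \<in> index_box (N ^ m) \<times> index_box N"
      using Npos by (auto simp: index_box_def par_def digit_def)
  next
    fix x :: "('n \<Rightarrow> int) \<times> ('n \<Rightarrow> int)"
    assume "x \<in> index_box (N ^ m) \<times> index_box N"
    then obtain p d where x: "x = (p, d)" "p \<in> index_box (N ^ m)" "d \<in> index_box N" by auto
    have *: "(int N * p i + d i) div int N = p i" "d i mod int N = d i"
      "0 \<le> int N * p i + d i" "int N * p i + d i < int N * int (N ^ m)" for i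
    proof -
      have "0 \<le> p i" "p i < int (N ^ m)" "0 \<le> d i" "d i < int N"
        using x(2,3) by (auto simp: index_box_def)
      then have b: "0 \<le> p i" "p i + 1 \<le> int (N ^ m)" "0 \<le> d i" "d i < int N" by linarith+
      show "(int N * p i + d i) div int N = p i" "d i mod int N = d i"
        "0 \<le> int N * p i + d i" using b by simp_all
      have "int N * (p i + 1) \<le> int N * int (N ^ m)" using b by (intro mult_left_mono) auto
      then show "int N * p i + d i < int N * int (N ^ m)" using b by (simp add: distrib_left)
    qed
    show "(par (case x of (p, d) \<Rightarrow> \<lambda>i. int N * p i + d i), digit (case x of (p, d) \<Rightarrow> \<lambda>i. int N * p i + d i)) = x"
      by (simp add: x par_def digit_def *)
    show "(case x of (p, d) \<Rightarrow> \<lambda>i. int N * p i + d i) \<in> index_box (N ^ Suc m)"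
      using * by (simp add: x index_box_def)
  qed (auto simp: par_def digit_def)
  then show ?thesis by (simp add: sum_product sum.cartesian_product)
qed

lemma card_index_box_slice:
  fixes i :: "'n :: finite"
  shows "real (card {d \<in> index_box N. d i = e}) \<le> real N ^ CARD('n) / N"
proof -
  let ?A = "\<lambda>j. if j = i then {e} else {0..<int N}"
  have "{d \<in> index_box N. d i = e} \<subseteq> PiE UNIV ?A" by (auto simp: index_box_def)
  then have "card {d \<in> index_box N. d i = e} \<le> card (PiE UNIV ?A)"
    by (intro card_mono finite_PiE) auto
  also have "\<dots> = (\<Prod>j\<in>UNIV. card (?A j))" by (rule card_PiE) simp
  also have "\<dots> = (\<Prod>j\<in>UNIV - {i}. N)"
    by (subst prod.remove[of UNIV i]) auto
  also have "\<dots> = N ^ (CARD('n) - 1)" by (simp add: card_Diff_singleton)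
  finally have "real (card {d \<in> index_box N. d i = e}) \<le> real N ^ (CARD('n) - 1)"
    by (simp flip: of_nat_power)
  also have "\<dots> = real N ^ CARD('n) / N"
    using Npos power_minus_mult[of "CARD('n)" "real N"] by (simp add: field_simps)
  finally show ?thesis .
qed

text \<open>A union bound over the \<open>4 * CARD('n)\<close> slices of digit vectors in the two
  outer layers, where \<open>fac\<close> is at most \<open>K\<close>; elsewhere it equals
  \<open>q\<close>.\<close>

lemma sum_fac_powr:
  assumes s: "0 < s"
  shows "(\<Sum>d\<in>index_box N. fac (d :: 'n :: finite \<Rightarrow> int) powr s)
    \<le> real N ^ CARD('n) * (q powr s + 4 * CARD('n) / N * K powr s)"
proof -
  let ?Z = "{0, 1, int N - 2, int N - 1}"
  let ?h = "\<lambda>d :: 'n \<Rightarrow> int. \<Sum>i\<in>UNIV. \<Sum>e\<in>?Z. if d i = e then K powr s else 0"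
  have fac_le: "fac d powr s \<le> q powr s + ?h d" for d :: "'n \<Rightarrow> int"
  proof (cases "\<exists>i. d i \<in> ?Z")
    case True
    then obtain i where i: "d i \<in> ?Z" by blast
    have "fac d powr s \<le> K powr s" using fac_bounds[of d] s by (intro powr_mono2) auto
    also have "\<dots> \<le> (\<Sum>e\<in>?Z. if d i = e then K powr s else 0)" using i by (simp add: sum.delta')
    also have "\<dots> \<le> ?h d" by (rule member_le_sum) (auto intro!: sum_nonneg)
    finally show ?thesis by (simp add: add_increasing)
  next
    case False
    then have "fac d = q" by (auto simp: fac_def)
    moreover have "0 \<le> ?h d" by (intro sum_nonneg) auto
    ultimately show ?thesis by simp
  qed
  have "(\<Sum>d\<in>index_box N. fac (d :: 'n \<Rightarrow> int) powr s) \<le> (\<Sum>d\<in>index_box N. q powr s + ?h d)"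
    by (intro sum_mono fac_le)
  also have "\<dots> = real N ^ CARD('n) * q powr s + (\<Sum>d\<in>index_box N. ?h d)"
    by (simp add: sum.distrib card_index_box)
  also have "(\<Sum>d\<in>index_box N. ?h d) = (\<Sum>i\<in>(UNIV :: 'n set). \<Sum>e\<in>?Z. \<Sum>d\<in>index_box N. if d i = e then K powr s else 0)"
  proof -
    have "(\<Sum>d\<in>index_box N. ?h d) = (\<Sum>i\<in>(UNIV :: 'n set). \<Sum>d\<in>index_box N. \<Sum>e\<in>?Z. if d i = e then K powr s else 0)"
      by (rule sum.swap)
    also have "\<dots> = (\<Sum>i\<in>(UNIV :: 'n set). \<Sum>e\<in>?Z. \<Sum>d\<in>index_box N. if d i = e then K powr s else 0)"
      by (intro sum.cong refl sum.swap)
    finally show ?thesis .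
  qed
  also have "\<dots> \<le> (\<Sum>i\<in>(UNIV :: 'n set). \<Sum>e\<in>?Z. real N ^ CARD('n) / N * K powr s)"
  proof (intro sum_mono)
    fix i :: 'n and e :: int
    have "(\<Sum>d\<in>index_box N. if d i = e then K powr s else 0) = real (card {d \<in> index_box N. d i = e}) * K powr s"
      by (simp add: sum.If_cases Int_def)
    also have "\<dots> \<le> real N ^ CARD('n) / N * K powr s"
      by (intro mult_right_mono card_index_box_slice) auto
    finally show "(\<Sum>d\<in>index_box N. if d i = e then K powr s else 0) \<le> real N ^ CARD('n) / N * K powr s" .
  qed
  also have "\<dots> = CARD('n) * 4 * (real N ^ CARD('n) / N * K powr s)"
  proof -
    have "card ?Z = 4" using N8 by simp
    then show ?thesis by simp
  qed
  finally show ?thesis by (simp add: algebra_simps)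
qed

text \<open>This is Markov's inequality for the \<open>s\<close>-th moment of the weight.\<close>
lemma card_newly_frozen:
  assumes s: "0 < s" and small: "q powr s + 4 * CARD('n :: finite) / N * K powr s \<le> lam powr s / 2"
  shows "real (card {k \<in> index_box (N ^ Suc m). active m (par k) \<and> \<not> active (Suc m) (k :: 'n \<Rightarrow> int)})
    \<le> B powr - s * (1/2) ^ Suc m * (real N ^ CARD('n)) ^ Suc m"
proof -
  define S where "S = (\<Sum>d\<in>index_box N. fac (d :: 'n \<Rightarrow> int) powr s)"
  \<comment> \<open>The moment is truncated to active cubes, so that each generation multiplies it
    by at most \<open>S\<close>.\<close>
  define f where "f m k = (if active m k then wt m k powr s else 0)" for m and k :: "'n \<Rightarrow> int"
  define T where "T m = (\<Sum>k\<in>index_box (N ^ m). f m k)" for m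
  let ?Y = "real N ^ CARD('n) * (lam powr s / 2)"
  have S: "0 \<le> S" "S \<le> ?Y"
  proof -
    show "0 \<le> S" by (auto simp: S_def intro: sum_nonneg)
    have "S \<le> real N ^ CARD('n) * (q powr s + 4 * CARD('n) / N * K powr s)"
      unfolding S_def by (rule sum_fac_powr[OF s])
    also have "\<dots> \<le> ?Y" by (intro mult_left_mono small) auto
    finally show "S \<le> ?Y" .
  qed
  have TS: "(\<Sum>k\<in>index_box (N ^ Suc m). f m (par k) * fac (digit k) powr s) = T m * S" for m
    unfolding T_def S_def by (rule sum_index_box_Suc)
  have wt_powr: "wt (Suc m) k powr s = f m (par k) * fac (digit k) powr s" if "active m (par k)" for m and k :: "'n \<Rightarrow> int"
    using that wt_pos[of m "par k"] fac_bounds[of "digit k"]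
    by (simp add: wt_Suc f_def powr_mult less_imp_le del: wt.simps(2))
  have f_nonneg: "0 \<le> f m k" for m k by (simp add: f_def)
  have T: "T m \<le> S ^ m" for m
  proof (induction m)
    case 0
    have "card (index_box 1 :: ('n \<Rightarrow> int) set) = 1" by (simp add: card_index_box)
    then show ?case using B by (simp add: T_def f_def active_def)
  next
    case (Suc m)
    have "T (Suc m) \<le> (\<Sum>k\<in>index_box (N ^ Suc m). f m (par k) * fac (digit k) powr s)"
      unfolding T_def
    proof (rule sum_mono)
      fix k :: "'n \<Rightarrow> int"
      show "f (Suc m) k \<le> f m (par k) * fac (digit k) powr s"
        using wt_powr[of m k] active_par[of m k] f_nonneg
        by (cases "active (Suc m) k") (simp_all add: f_def[of "Suc m"] del: wt.simps(2))
    qed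
    also have "\<dots> \<le> S ^ m * S" unfolding TS using Suc S by (intro mult_right_mono) auto
    finally show ?case by (simp add: mult.commute)
  qed
  let ?F = "{k \<in> index_box (N ^ Suc m). active m (par k) \<and> \<not> active (Suc m) (k :: 'n \<Rightarrow> int)}"
  \<comment> \<open>A newly frozen cube has weight above \<open>B * lam ^ Suc m\<close>, so
    \<open>?b\<close> is the threshold in Markov's inequality.\<close>
  let ?b = "(B * lam ^ Suc m) powr s"
  have "real (card ?F) * ?b = (\<Sum>k\<in>?F. ?b)" by simp
  also have "\<dots> \<le> (\<Sum>k\<in>?F. f m (par k) * fac (digit k) powr s)"
  proof (rule sum_mono)
    fix k assume k: "k \<in> ?F"
    then have "?b \<le> wt (Suc m) k powr s"
      using B lam s by (intro powr_mono2) (auto simp: active_def simp del: wt.simps(2) power_Suc)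
    then show "?b \<le> f m (par k) * fac (digit k) powr s" using wt_powr k by simp
  qed
  also have "\<dots> \<le> (\<Sum>k\<in>index_box (N ^ Suc m). f m (par k) * fac (digit k) powr s)"
    by (intro sum_mono2) (auto simp: f_nonneg)
  also have "\<dots> \<le> S ^ m * S" unfolding TS using T S by (intro mult_right_mono) auto
  also have "\<dots> = S ^ Suc m" by simp
  also have "\<dots> \<le> ?Y ^ Suc m" using S by (intro power_mono) auto
  finally have 1: "real (card ?F) * ?b \<le> ?Y ^ Suc m" .
  have "?b = B powr s * (lam powr s) ^ Suc m"
  proof -
    have "(lam ^ Suc m) powr s = (lam powr s) ^ Suc m"
      using lam by (simp add: powr_realpow[symmetric] powr_powr mult.commute del: power_Suc)
    then show ?thesis using B lam by (simp add: powr_mult del: power_Suc)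
  qed
  moreover have "?Y ^ Suc m = (real N ^ CARD('n)) ^ Suc m * (1/2) ^ Suc m * (lam powr s) ^ Suc m"
    unfolding power_mult_distrib[symmetric] by simp
  moreover have "0 < (lam powr s) ^ Suc m" using lam by simp
  \<comment> \<open>Cancelling the powers of \<open>lam powr s\<close> leaves the factor
    \<open>(1/2) ^ Suc m\<close>, which is summable over the generations.\<close>
  ultimately have "real (card ?F) * B powr s \<le> (real N ^ CARD('n)) ^ Suc m * (1/2) ^ Suc m"
    using 1 by (simp only: mult.assoc[symmetric] mult_le_cancel_right_pos)
  then show ?thesis using B by (simp add: powr_minus field_simps)
qed

lemma emeasure_cube: "emeasure lborel (cube m k :: (real ^ 'n) set) = ennreal (1 / (real N ^ CARD('n)) ^ m)"
  and cube_borel: "(cube m k :: (real ^ 'n) set) \<in> sets borel"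
proof -
  let ?a = "(\<chi> i. of_int (k i) / real N ^ m) :: real ^ 'n"
  let ?b = "(\<chi> i. (of_int (k i) + 1) / real N ^ m) :: real ^ 'n"
  have cb: "cube m k = cbox ?a ?b"
    using Npos by (auto simp: cube_def mem_box_cart field_simps)
  then show "(cube m k :: (real ^ 'n) set) \<in> sets borel" by simp
  have diff: "(?b - ?a) \<bullet> e = 1 / real N ^ m" if "e \<in> Basis" for e
    using that by (auto simp: Basis_vec_def inner_axis diff_divide_distrib[symmetric])
  have le: "?a \<bullet> e \<le> ?b \<bullet> e" if "e \<in> Basis" for e
    using diff[OF that] by (simp add: inner_diff_left) (smt (verit) NNpos zero_less_divide_1_iff)
  have "emeasure lborel (cbox ?a ?b) = ennreal (\<Prod>e\<in>Basis. (?b - ?a) \<bullet> e)"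
    by (rule emeasure_lborel_cbox) (rule le)
  also have "(\<Prod>e\<in>Basis. (?b - ?a) \<bullet> e) = (\<Prod>e\<in>(Basis :: (real ^ 'n) set). 1 / real N ^ m)"
    by (intro prod.cong refl diff)
  also have "\<dots> = 1 / (real N ^ CARD('n)) ^ m"
    by (simp add: power_one_over power_mult[symmetric] mult.commute)
  finally show "emeasure lborel (cube m k :: (real ^ 'n) set) = ennreal (1 / (real N ^ CARD('n)) ^ m)"
    by (simp add: cb)
qed

lemma good_borel: "(good :: (real ^ 'n) set) \<in> sets borel"
proof -
  have idx: "{x :: real ^ 'n. idx m x = k} \<in> sets borel" for m k
  proof -
    have "{x :: real ^ 'n. idx m x = k} = (\<Inter>i. {x. \<lfloor>real N ^ m * x $ i\<rfloor> = k i})"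
      by (auto simp: idx_def fun_eq_iff)
    moreover have "{x :: real ^ 'n. \<lfloor>real N ^ m * x $ i\<rfloor> = k i} \<in> sets borel" for i by measurable
    ultimately show ?thesis by auto
  qed
  have "{x :: real ^ 'n. active m (idx m x)} \<in> sets borel" for m
  proof -
    have "{x :: real ^ 'n. active m (idx m x)} = (\<Union>k\<in>{k. active m k}. {x. idx m x = k})" by auto
    then show ?thesis using idx by (auto intro!: sets.countable_UN')
  qed
  then have "cbox 0 1 \<inter> (\<Inter>m. {x :: real ^ 'n. active m (idx m x)}) \<in> sets borel" by auto
  moreover have "good = cbox 0 1 \<inter> (\<Inter>m. {x :: real ^ 'n. active m (idx m x)})"
    by (auto simp: good_def)
  ultimately show ?thesis by simp
qed

text \<open>In the open cube no coordinate reaches \<open>1\<close>, so these points fall into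
  exactly the indices counted by the moment estimate.\<close>

lemma idx_box: assumes "x \<in> box 0 (1 :: real ^ 'n)" shows "idx m x \<in> index_box (N ^ m)"
proof -
  have "0 \<le> idx m x i \<and> idx m x i < int (N ^ m)" for i
  proof -
    have x: "0 < x $ i" "x $ i < 1" using assms by (auto simp: mem_box_cart)
    then have "real N ^ m * x $ i < real N ^ m * 1" by (intro mult_strict_left_mono NNpos)
    then have "real N ^ m * x $ i < of_int (int (N ^ m))" by simp
    then have "\<lfloor>real N ^ m * x $ i\<rfloor> < int (N ^ m)" by (simp only: floor_less_iff)
    then show ?thesis using x Npos by (simp add: idx_def)
  qed
  then show ?thesis by (simp add: index_box_def)
qed

text \<open>A point of the open unit cube outside \<open>good\<close> has a first frozen generation.
  The cubes newly frozen at generation \<open>m + 1\<close> have total measure at most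
  \<open>B powr - s * (1/2) ^ Suc m\<close>, and these bounds sum to
  \<open>B powr - s\<close>.\<close>

lemma measure_good:
  assumes s: "0 < s" and small: "q powr s + 4 * CARD('n :: finite) / N * K powr s \<le> lam powr s / 2"
  shows "1 - B powr - s \<le> measure lebesgue (good :: (real ^ 'n) set)"
proof -
  let ?F = "\<lambda>m. {k \<in> index_box (N ^ Suc m). active m (par k) \<and> \<not> active (Suc m) (k :: 'n \<Rightarrow> int)}"
  define A where "A m = ((\<Union>k\<in>?F m. cube (Suc m) k) :: (real ^ 'n) set)" for m
  have A_borel [measurable]: "A m \<in> sets borel" for m
    unfolding A_def by (intro sets.finite_UN cube_borel) auto
  have A: "emeasure lborel (A m) \<le> ennreal (B powr - s * (1/2) ^ Suc m)" for m
  proof -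
    have "emeasure lborel (A m) \<le> (\<Sum>k\<in>?F m. emeasure lborel (cube (Suc m) k :: (real ^ 'n) set))"
      unfolding A_def using cube_borel by (intro emeasure_subadditive_finite) auto
    also have "\<dots> = ennreal (real (card (?F m)) * (1 / (real N ^ CARD('n)) ^ Suc m))"
      unfolding emeasure_cube sum_constant ennreal_of_nat_eq_real_of_nat
      by (rule ennreal_mult[symmetric]) auto
    also have "\<dots> \<le> ennreal (B powr - s * (1/2) ^ Suc m)"
    proof (rule ennreal_leI)
      have "real (card (?F m)) * (1 / (real N ^ CARD('n)) ^ Suc m)
        \<le> B powr - s * (1/2) ^ Suc m * (real N ^ CARD('n)) ^ Suc m * (1 / (real N ^ CARD('n)) ^ Suc m)"
        by (intro mult_right_mono card_newly_frozen s small) simp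
      also have "\<dots> = B powr - s * (1/2) ^ Suc m" using Npos by simp
      finally show "real (card (?F m)) * (1 / (real N ^ CARD('n)) ^ Suc m) \<le> B powr - s * (1/2) ^ Suc m" .
    qed
    finally show ?thesis .
  qed
  have sums: "(\<lambda>m. B powr - s * (1/2) ^ Suc m) sums (B powr - s * 1)"
    by (intro sums_mult power_half_series)
  have "emeasure lborel (\<Union>m. A m) \<le> (\<Sum>m. emeasure lborel (A m))"
    by (intro emeasure_subadditive_countably) (auto simp: A_borel)
  also have "\<dots> \<le> (\<Sum>m. ennreal (B powr - s * (1/2) ^ Suc m))" by (intro suminf_le A) auto
  also have "\<dots> = ennreal (B powr - s)"
    by (subst suminf_ennreal_eq[OF _ sums]) simp_all
  finally have bad: "emeasure lborel (\<Union>m. A m) \<le> ennreal (B powr - s)" .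
  have cover: "box 0 1 \<subseteq> good \<union> (\<Union>m. A m)"
  proof
    fix x :: "real ^ 'n" assume x: "x \<in> box 0 1"
    show "x \<in> good \<union> (\<Union>m. A m)"
    proof (cases "\<forall>m. active m (idx m x)")
      case True
      then show ?thesis using x box_subset_cbox by (auto simp: good_def)
    next
      case False
      define m where "m = (LEAST m. \<not> active m (idx m x))"
      have m: "\<not> active m (idx m x)" unfolding m_def using False by (metis LeastI)
      \<comment> \<open>Generation \<open>0\<close> is active because \<open>1 \<le> B\<close>, so
        the first frozen generation has a predecessor.\<close>
      moreover have "active 0 (idx 0 x)" using B by (simp add: active_def)
      ultimately have "m \<noteq> 0" by (cases "m = 0") auto
      then obtain m' where m': "m = Suc m'" using not0_implies_Suc by blast
      have "active m' (idx m' x)" using not_less_Least[of m' "\<lambda>m. \<not> active m (idx m x)"] m'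
        by (auto simp flip: m_def)
      then have "idx (Suc m') x \<in> ?F m'" using m m' idx_box[OF x, of "Suc m'"] by (simp add: par_idx)
      then have "x \<in> A m'" using cube_idx[of x "Suc m'"] unfolding A_def by blast
      then show ?thesis by blast
    qed
  qed
  have one: "(1 :: real ^ 'n) \<bullet> b = 1" if "b \<in> Basis" for b
    using that by (auto simp: Basis_vec_def inner_axis)
  have "ennreal 1 = emeasure lborel (box 0 (1 :: real ^ 'n))"
    by (simp add: emeasure_lborel_box_eq one)
  also have "\<dots> \<le> emeasure lborel (good \<union> (\<Union>m. A m))"
    using cover good_borel A_borel by (intro emeasure_mono) auto
  also have "\<dots> \<le> emeasure lborel (good :: (real ^ 'n) set) + emeasure lborel (\<Union>m. A m)"
    using good_borel A_borel by (intro emeasure_subadditive) auto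
  also have "\<dots> \<le> emeasure lborel (good :: (real ^ 'n) set) + ennreal (B powr - s)"
    by (intro add_left_mono bad)
  also have "emeasure lborel (good :: (real ^ 'n) set) = ennreal (measure lborel (good :: (real ^ 'n) set))"
  proof (rule emeasure_eq_ennreal_measure)
    have "emeasure lborel (good :: (real ^ 'n) set) \<le> emeasure lborel (cbox 0 (1 :: real ^ 'n))"
      by (intro emeasure_mono) (auto simp: good_def)
    then show "emeasure lborel (good :: (real ^ 'n) set) \<noteq> top"
      using emeasure_lborel_cbox_finite[of 0 "1 :: real ^ 'n"] by (auto simp: top_unique)
  qed
  finally have "ennreal 1 \<le> ennreal (measure lborel (good :: (real ^ 'n) set) + B powr - s)"
    by (simp add: ennreal_plus)
  then have "1 \<le> measure lborel (good :: (real ^ 'n) set) + B powr - s"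
    by (subst (asm) ennreal_le_iff) (auto intro: add_nonneg_nonneg)
  moreover have "measure lebesgue (good :: (real ^ 'n) set) = measure lborel (good :: (real ^ 'n) set)"
    by (rule measure_completion) (simp add: good_borel)
  ultimately show ?thesis by linarith
qed

end

section \<open>Choice of the parameters and conclusion\<close>

theorem theorem1p2:
  fixes \<alpha> \<delta> :: real
  assumes "CARD('n::finite) \<ge> 2"
    and "0 < \<alpha>" and "\<alpha> < real CARD('n)"
    and "0 < \<delta>" and "\<delta> < 1"
  shows "\<exists>(X :: (real ^ 'n) set) (d :: real ^ 'n \<Rightarrow> real ^ 'n \<Rightarrow> real) (f :: real ^ 'n \<Rightarrow> real ^ 'n).
    Metric_space X d \<and>
    hausdorff_measure X d (real CARD('n)) X < \<infinity> \<and>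
    quasisymmetric_homeomorphism (cbox 0 1) dist X d f \<and>
    (\<exists>E. E \<in> sets borel \<and> E \<subseteq> cbox 0 1 \<and> measure lebesgue E \<ge> \<delta> \<and>
       hausdorff_dimension X d (f ` E) \<le> ennreal \<alpha>)"
proof -
  define n where "n = CARD('n)"
  \<comment> \<open>Makes \<open>sqrt N = 16 * n\<close>, so that
    \<open>4 * n / N * sqrt N = 1/4\<close> in the bound for the outer layers.\<close>
  define N where "N = 256 * n ^ 2"
  define D where "D = real n / \<alpha>"
  \<comment> \<open>Makes \<open>s + s * D = 1/2\<close>, hence
    \<open>N powr s = sqrt N * lam powr s\<close>.\<close>
  define s where "s = 1 / (2 * (D + 1))"
  \<comment> \<open>Gives \<open>lam powr \<alpha> = N powr - n\<close>, which balances the number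
    of cubes in the dimension estimate.\<close>
  define lam where "lam = real N powr - D"
  \<comment> \<open>Gives \<open>q powr s = lam powr s / 4\<close>, the other half of the moment
    condition \<open>small\<close>.\<close>
  define q where "q = lam * 4 powr (- 1 / s)"
  \<comment> \<open>Gives \<open>B powr - s = 1 - \<delta>\<close>, the admissible loss of
    measure.\<close>
  define B where "B = (1 / (1 - \<delta>)) powr (1 / s)"
  have n: "2 \<le> n" using assms by (simp add: n_def)
  have N1: "256 \<le> N" using n by (simp add: N_def)
  have D: "0 < D" using n assms by (simp add: D_def)
  have s: "0 < s" using D by (simp add: s_def)
  have lam: "0 < lam" "lam \<le> 1"
    using N1 D by (auto simp: lam_def powr_minus divide_simps ge_one_powr_ge_zero)
  have "(4 :: real) powr (- 1 / s) \<le> 4 powr 0" using s by (intro powr_mono) auto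
  then have q: "0 < q" "q \<le> 1"
    using lam by (auto simp: q_def intro: mult_le_one)
  have "1 \<le> 1 / (1 - \<delta>)" using assms by simp
  then have B: "1 \<le> B" unfolding B_def using s by (intro ge_one_powr_ge_zero) auto
  interpret weight_cascade N q lam B
    using N1 q lam B by unfold_locales auto
  have Bs: "B powr - s = 1 - \<delta>"
    using assms s by (simp add: B_def powr_powr powr_minus)
  have "lam powr \<alpha> = real N powr - real n" using assms by (simp add: lam_def powr_powr D_def)
  then have lam\<alpha>: "lam powr \<alpha> * real N ^ CARD('n) = 1"
    using N1 by (simp add: powr_minus powr_realpow n_def)
  have small: "q powr s + 4 * CARD('n) / N * K powr s \<le> lam powr s / 2"
  proof -
    have "q powr s = lam powr s / 4"
    proof -
      have "(4 powr (- 1 / s)) powr s = (4 :: real) powr - 1" unfolding powr_powr using s by simp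
      then show ?thesis using lam by (simp add: q_def powr_mult)
    qed
    moreover have "4 * real n / N * K powr s \<le> lam powr s / 4"
    proof -
      have sq: "real N powr (1/2) = 16 * n"
      proof -
        have "real N = (16 * real n)\<^sup>2" by (simp add: N_def power_mult_distrib)
        then have "sqrt (real N) = \<bar>16 * real n\<bar>" by (simp only: real_sqrt_abs)
        then show ?thesis by (simp add: powr_half_sqrt)
      qed
      have "s * (D + 1) = 1/2" using D by (simp add: s_def)
      then have e: "s + s * D = 1/2" by (simp add: distrib_left)
      have "4 * real n / N * K powr s \<le> 4 * real n / N * real N powr s"
        using K_bounds s by (intro mult_left_mono powr_mono2) auto
      also have "real N powr s = real N powr (1/2) * real N powr - (s * D)"
        unfolding e[symmetric] by (simp flip: powr_add)
      also have "real N powr - (s * D) = lam powr s" by (simp add: lam_def powr_powr mult.commute)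
      also have "4 * real n / N * (real N powr (1/2) * lam powr s) = lam powr s / 4"
        unfolding sq using n by (simp add: N_def power2_eq_square)
      finally show ?thesis .
    qed
    ultimately show ?thesis by (simp add: n_def)
  qed
  show ?thesis
  proof (intro exI conjI)
    show "Metric_space (cbox 0 (1 :: real ^ 'n)) cdist" by (rule Metric_space_cdist)
    show "hausdorff_measure (cbox 0 1) cdist (real CARD('n)) (cbox 0 (1 :: real ^ 'n)) < \<infinity>"
      by (rule hausdorff_measure_cbox)
    show "quasisymmetric_homeomorphism (cbox 0 (1 :: real ^ 'n)) dist (cbox 0 1) cdist (\<lambda>x. x)"
      by (rule cdist_quasisymmetric)
    show "(good :: (real ^ 'n) set) \<in> sets borel" by (rule good_borel)
    show "(good :: (real ^ 'n) set) \<subseteq> cbox 0 1" by (auto simp: good_def)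
    show "\<delta> \<le> measure lebesgue (good :: (real ^ 'n) set)" using measure_good[OF s small] Bs by simp
    show "hausdorff_dimension (cbox 0 1) cdist ((\<lambda>x. x) ` (good :: (real ^ 'n) set)) \<le> ennreal \<alpha>"
      using hausdorff_dimension_good[OF assms(2) lam\<alpha>] by simp
  qed
qed

end
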